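(* Let $r>0$ be real, let $k_r\in(0,1)$ be the elliptic singular modulus, and let $q=e^{-\pi\sqrt{r}}$. Then $$\sum_{n=0}^{\infty}\frac{\left(\frac{3}{2}\right)_n\left(-\frac{1}{2}\right)_n}{(n!)^2}\,(k_r)^{2n}\left[-4(1-k_r^2)\,n+1-2k_r^2\right]=\frac{2K(k_r)}{\pi}=\vartheta_3(q)^2 .$$
   Context: For $0\le x<1$, the complete elliptic integral of the first kind is $K(x)=\int_0^{\pi/2}\frac{d\theta}{\sqrt{1-x^2\sin^2\theta}}=\frac{\pi}{2}\,{}_2F_1\left(\frac12,\frac12;1;x^2\right)$ (the argument $x$ is the modulus). For $r>0$, the elliptic singular modulus $k_r$ is the unique number in $(0,1)$ with $\frac{K\left(\sqrt{1-k_r^2}\right)}{K(k_r)}=\sqrt{r}$. The Pochhammer symbol is $(a)_n=a(a+1)\cdots(a+n-1)$, $(a)_0=1$. The theta function is $\vartheta_3(q)=\sum_{n=-\infty}^{\infty}q^{n^2}$ for $|q|<1$. *)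

theory Defs
  imports "HOL-Analysis.Analysis"
begin

(* The argument is the modulus, not the parameter x^2. Only 0 <= x < 1 is meaningful; there the
   integrand is continuous on the closed interval. *)
definition elliptic_K :: "real \<Rightarrow> real" where
  "elliptic_K x = integral {0..pi / 2} (\<lambda>\<theta>. 1 / sqrt (1 - x\<^sup>2 * (sin \<theta>)\<^sup>2))"

definition singular_modulus :: "real \<Rightarrow> real" where
  "singular_modulus r =
    (THE k. 0 < k \<and> k < 1 \<and> elliptic_K (sqrt (1 - k\<^sup>2)) / elliptic_K k = sqrt r)"

(* Unordered sum over all integers; it converges absolutely for norm q < 1, with 0 powi 0 = 1. *)
definition theta3 :: "'a :: {real_normed_field, banach} \<Rightarrow> 'a" where
  "theta3 q = (\<Sum>\<^sub>\<infinity>n::int. q powi (n\<^sup>2))"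

end

theory Submission
  imports Defs
begin

text \<open>
  Write \<open>\<theta>\<^sub>4(q) = \<theta>\<^sub>3(- q)\<close>. One step of the arithmetic-geometric mean sends
  \<open>(\<theta>\<^sub>3(q)\<^sup>2, \<theta>\<^sub>4(q)\<^sup>2)\<close> to \<open>(\<theta>\<^sub>3(q\<^sup>2)\<^sup>2, \<theta>\<^sub>4(q\<^sup>2)\<^sup>2)\<close>, and iterating leads to \<open>(1, 1)\<close>. By Landen's
  transformation the complete elliptic integral is unchanged along the way, so
  \<open>K(k) = \<pi> / 2 * \<theta>\<^sub>3(q)\<^sup>2\<close> for the modulus \<open>k\<close> with \<open>k' = \<theta>\<^sub>4(q)\<^sup>2 / \<theta>\<^sub>3(q)\<^sup>2\<close>.

  That this \<open>k\<close> is the singular modulus is usually deduced from the modular transformation of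
  \<open>\<theta>\<^sub>3\<close>, i.e. from Poisson summation. Instead, Landen's transformation shows that
  \<open>M(q) = K(k') / \<theta>\<^sub>3(q)\<^sup>2\<close> satisfies \<open>M(q\<^sup>2) = 2 M(q)\<close>, so \<open>M(q) / (- ln q)\<close> is constant along
  \<open>q, q\<^sup>2, q\<^sup>4, \<dots>\<close>. Its limit is \<open>1 / 2\<close> because \<open>K(k') = - ln k + O(1)\<close> and \<open>k\<^sup>2 \<sim> 16 q\<close> as
  \<open>q \<rightarrow> 0\<close>. Hence \<open>K(k') / K(k) = - ln q / \<pi> = sqrt r\<close>.

  The series differs from the hypergeometric series of \<open>2 K(k) / \<pi>\<close> by a telescoping series.
\<close>

subsection \<open>Theta functions\<close>

lemma theta3_term_nat: "q powi (n\<^sup>2) = q ^ (nat \<bar>n\<bar>)\<^sup>2" for q :: real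
proof -
  have "n\<^sup>2 = int ((nat \<bar>n\<bar>)\<^sup>2)" by simp
  then show ?thesis by (metis power_int_of_nat)
qed

text \<open>The integers split into 0 and two half-lines with equal sums. This links the unordered
  sum in \<open>theta3\<close> to an ordinary series, where estimates are easy.\<close>

lemma has_sum_even_int:
  fixes f :: "nat \<Rightarrow> real"
  assumes "summable (\<lambda>n. \<bar>f (Suc n)\<bar>)"
  shows "((\<lambda>n. f (nat \<bar>n\<bar>)) has_sum (f 0 + 2 * (\<Sum>n. f (Suc n)))) UNIV"
proof -
  let ?S = "\<Sum>n. f (Suc n)"
  have s: "((\<lambda>n. f (Suc n)) has_sum ?S) UNIV"
    by (rule norm_summable_imp_has_sum)
      (use assms in \<open>simp_all add: summable_sums summable_rabs_cancel\<close>)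
  have "((\<lambda>n. f (nat \<bar>n\<bar>)) has_sum ?S) {1..}"
    by (rule has_sum_reindex_bij_witness[of "{1..}" "\<lambda>n. int (Suc n)" "\<lambda>n. nat n - 1" UNIV, THEN iffD2, OF _ _ _ _ _ refl s])
      (auto simp: Suc_diff_le nat_le_iff)
  moreover have "((\<lambda>n. f (nat \<bar>n\<bar>)) has_sum ?S) {..-1}"
    by (rule has_sum_reindex_bij_witness[of "{..-1}" "\<lambda>n. - int (Suc n)" "\<lambda>n. nat (-n) - 1" UNIV, THEN iffD2, OF _ _ _ _ _ refl s])
      (auto simp: Suc_diff_le nat_le_iff)
  ultimately have "((\<lambda>n. f (nat \<bar>n\<bar>)) has_sum (?S + ?S)) ({1..} \<union> {..-1})"
    by (rule has_sum_Un_disjoint) auto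
  note nz = this
  have "((\<lambda>n. f (nat \<bar>n\<bar>)) has_sum (f 0)) {0}"
    using has_sum_finite[of "{0}" "\<lambda>n::int. f (nat \<bar>n\<bar>)"] by simp
  from this nz have "((\<lambda>n. f (nat \<bar>n\<bar>)) has_sum (f 0 + (?S + ?S))) ({0} \<union> ({1..} \<union> {..-1}))"
    by (rule has_sum_Un_disjoint) auto
  moreover have "{0} \<union> ({1..} \<union> {..-1}) = (UNIV :: int set)" by auto
  ultimately show ?thesis by simp
qed

lemma summable_square_powers:
  fixes q :: real assumes "\<bar>q\<bar> < 1"
  shows "summable (\<lambda>n. \<bar>q ^ (Suc n)\<^sup>2\<bar>)"
proof (rule summable_comparison_test)
  show "summable (\<lambda>n. \<bar>q\<bar> ^ n)" using assms by (simp add: summable_geometric)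
  have "\<bar>q\<bar> ^ (Suc n)\<^sup>2 \<le> \<bar>q\<bar> ^ n" for n
    using assms by (intro power_decreasing) (auto simp: power2_eq_square)
  then show "\<exists>N. \<forall>n\<ge>N. norm \<bar>q ^ (Suc n)\<^sup>2\<bar> \<le> \<bar>q\<bar> ^ n" by (auto simp: power_abs)
qed

lemma theta3_has_sum:
  fixes q :: real assumes "\<bar>q\<bar> < 1"
  shows "((\<lambda>n. q powi (n\<^sup>2)) has_sum theta3 q) UNIV"
    and "theta3 q = 1 + 2 * (\<Sum>n. q ^ (Suc n)\<^sup>2)"
proof -
  have *: "((\<lambda>n. q powi (n\<^sup>2)) has_sum (1 + 2 * (\<Sum>n. q ^ (Suc n)\<^sup>2))) UNIV"
    using has_sum_even_int[of "\<lambda>n. q ^ n\<^sup>2"] summable_square_powers[OF assms]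
    by (simp add: theta3_term_nat)
  then show "theta3 q = 1 + 2 * (\<Sum>n. q ^ (Suc n)\<^sup>2)"
    by (simp add: theta3_def infsumI)
  with * show "((\<lambda>n. q powi (n\<^sup>2)) has_sum theta3 q) UNIV" by simp
qed

section \<open>Relations between \<open>theta3\<close> at \<open>q\<close>, \<open>- q\<close> and
  powers of \<open>q\<close>\<close>

lemma theta3_uminus_term: "(- q) powi (n\<^sup>2) = (if even n then q powi (n\<^sup>2) else - (q powi (n\<^sup>2)))" for q :: real
proof -
  have "even ((nat \<bar>n\<bar>)\<^sup>2) \<longleftrightarrow> even n" by (simp add: even_nat_iff)
  then show ?thesis by (simp add: theta3_term_nat)
qed

text \<open>Odd \<open>n\<close> cancel, and \<open>n = 2 * m\<close> contributes twice the
  \<open>m\<close>-th term at \<open>q ^ 4\<close>.\<close>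

lemma theta3_add_uminus:
  fixes q :: real assumes "\<bar>q\<bar> < 1"
  shows "theta3 q + theta3 (- q) = 2 * theta3 (q ^ 4)"
proof -
  have q4: "\<bar>q ^ 4\<bar> < 1" using assms by (metis abs_ge_zero power_abs power_less_one_iff zero_less_numeral)
  have "((\<lambda>n. q powi (n\<^sup>2) + (- q) powi (n\<^sup>2)) has_sum (theta3 q + theta3 (- q))) UNIV"
    using assms by (intro has_sum_add theta3_has_sum) auto
  moreover have "((\<lambda>n. q powi (n\<^sup>2) + (- q) powi (n\<^sup>2)) has_sum (2 * theta3 (q ^ 4))) UNIV \<longleftrightarrow>
      ((\<lambda>n. 2 * (q powi (n\<^sup>2))) has_sum (2 * theta3 (q ^ 4))) {n. even n}"
    by (rule has_sum_cong_neutral) (auto simp: theta3_uminus_term)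
  moreover have "((\<lambda>n. 2 * (q powi (n\<^sup>2))) has_sum (2 * theta3 (q ^ 4))) {n. even n} \<longleftrightarrow>
     ((\<lambda>n. 2 * ((q ^ 4) powi (n\<^sup>2))) has_sum (2 * theta3 (q ^ 4))) UNIV"
  proof (rule has_sum_reindex_bij_witness[of _ "\<lambda>n. 2 * n" "\<lambda>n. n div 2"])
    fix a :: int assume a: "a \<in> {n. even n}"
    then obtain b where b: "a = 2 * b" by (auto elim: evenE)
    have "nat \<bar>2 * b\<bar> = 2 * nat \<bar>b\<bar>" by simp
    then show "2 * (q ^ 4) powi (a div 2)\<^sup>2 = 2 * q powi a\<^sup>2"
      unfolding theta3_term_nat b by (simp add: power_mult power_mult_distrib)
  qed auto
  ultimately show ?thesis
    using has_sum_cmult_right[OF theta3_has_sum(1)[OF q4], of 2] has_sum_unique by blast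
qed

text \<open>Absolute convergence makes the square a sum over the lattice of integer pairs, which may
  then be reindexed.\<close>

lemma theta3_square_has_sum:
  fixes q :: real assumes "\<bar>q\<bar> < 1"
  shows "((\<lambda>(m, n). q powi (m\<^sup>2) * q powi (n\<^sup>2)) has_sum (theta3 q)\<^sup>2) UNIV"
proof -
  let ?f = "\<lambda>n::int. q powi (n\<^sup>2)"
  have s: "?f summable_on UNIV" using theta3_has_sum(1)[OF assms] by (auto simp: summable_on_def)
  have sn: "(\<lambda>n. norm (?f n)) summable_on UNIV"
    using s by (rule summable_on_iff_abs_summable_on_real[THEN iffD1])
  have "(\<lambda>(m, n). ?f m * ?f n) summable_on (UNIV \<times> UNIV)"
  proof (rule abs_summable_summable, subst Infinite_Sum.abs_summable_on_Sigma_iff, intro conjI ballI)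
    fix x show "(\<lambda>y. norm (case (x, y) of (m, n) \<Rightarrow> ?f m * ?f n)) summable_on UNIV"
      using summable_on_cmult_right[OF sn, of "\<bar>?f x\<bar>"] by (simp add: abs_mult)
  next
    have "(\<lambda>x. norm (?f x) * (\<Sum>\<^sub>\<infinity>y. norm (?f y))) summable_on UNIV"
      by (rule summable_on_cmult_left[OF sn])
    then show "(\<lambda>x. norm (\<Sum>\<^sub>\<infinity>y. norm (case (x, y) of (m, n) \<Rightarrow> ?f m * ?f n))) summable_on UNIV"
      by (simp add: abs_mult infsum_cmult_right' infsum_nonneg)
  qed
  note su = this
  have "infsum (\<lambda>(m, n). ?f m * ?f n) (UNIV \<times> UNIV) = (\<Sum>\<^sub>\<infinity>m. \<Sum>\<^sub>\<infinity>n. ?f m * ?f n)"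
    using infsum_Sigma'_banach[OF su] by simp
  also have "\<dots> = (theta3 q)\<^sup>2"
    by (simp add: infsum_cmult_right' infsum_cmult_left' theta3_def power2_eq_square)
  finally show ?thesis using has_sum_infsum[OF su] by simp
qed

text \<open>The arithmetic mean. Pairs with \<open>m + n\<close> odd cancel; the others are
  \<open>m = a + b\<close>, \<open>n = a - b\<close> with \<open>a\<close>, \<open>b\<close>
  arbitrary integers, and then m^2 + n^2 = 2 (a^2 + b^2).\<close>

lemma theta3_square_add_uminus:
  fixes q :: real assumes "\<bar>q\<bar> < 1"
  shows "(theta3 q)\<^sup>2 + (theta3 (- q))\<^sup>2 = 2 * (theta3 (q\<^sup>2))\<^sup>2"
proof -
  let ?g = "\<lambda>q. \<lambda>(m::int, n::int). q powi (m\<^sup>2) * q powi (n\<^sup>2) :: real"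
  have q2: "\<bar>q\<^sup>2\<bar> < 1" using assms by (simp add: abs_square_less_1)
  have "((\<lambda>x. ?g q x + ?g (- q) x) has_sum ((theta3 q)\<^sup>2 + (theta3 (- q))\<^sup>2)) UNIV"
    using assms by (intro has_sum_add theta3_square_has_sum) auto
  moreover have "((\<lambda>x. ?g q x + ?g (- q) x) has_sum (2 * (theta3 (q\<^sup>2))\<^sup>2)) UNIV \<longleftrightarrow>
      ((\<lambda>x. 2 * ?g q x) has_sum (2 * (theta3 (q\<^sup>2))\<^sup>2)) {(m, n). even (m + n)}"
    by (rule has_sum_cong_neutral) (auto simp: theta3_uminus_term split: if_splits)
  moreover have "((\<lambda>x. 2 * ?g q x) has_sum (2 * (theta3 (q\<^sup>2))\<^sup>2)) {(m, n). even (m + n)} \<longleftrightarrow>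
     ((\<lambda>x. 2 * ?g (q\<^sup>2) x) has_sum (2 * (theta3 (q\<^sup>2))\<^sup>2)) UNIV"
  proof (rule has_sum_reindex_bij_witness[of _ "\<lambda>(a, b). (a + b, a - b)" "\<lambda>(m, n). ((m + n) div 2, (m - n) div 2)"])
    fix x :: "int \<times> int" assume x: "x \<in> {(m, n). even (m + n)}"
    obtain m n where mn: "x = (m, n)" by (cases x)
    have "even (m + n)" using x unfolding mn by blast
    then obtain a where a: "m + n = 2 * a" by (rule evenE)
    define b where "b = a - n"
    have m: "m = a + b" and n: "n = a - b" using a by (auto simp: b_def)
    have "int ((nat \<bar>m\<bar>)\<^sup>2 + (nat \<bar>n\<bar>)\<^sup>2) = int (2 * ((nat \<bar>a\<bar>)\<^sup>2 + (nat \<bar>b\<bar>)\<^sup>2))"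
      by (simp add: m n power2_eq_square algebra_simps)
    then have "(nat \<bar>m\<bar>)\<^sup>2 + (nat \<bar>n\<bar>)\<^sup>2 = 2 * ((nat \<bar>a\<bar>)\<^sup>2 + (nat \<bar>b\<bar>)\<^sup>2)"
      by (simp only: of_nat_eq_iff)
    then have "?g q (m, n) = ?g (q\<^sup>2) (a, b)"
      by (simp add: theta3_term_nat distrib_left flip: power_add power_mult)
    then show "2 * ?g (q\<^sup>2) (case x of (m, n) \<Rightarrow> ((m + n) div 2, (m - n) div 2)) = 2 * ?g q x"
      by (simp add: mn m n)
    show "(case case x of (m, n) \<Rightarrow> ((m + n) div 2, (m - n) div 2) of (a, b) \<Rightarrow> (a + b, a - b)) = x"
      by (simp add: mn m n)
  qed auto
  ultimately show ?thesis
    using has_sum_cmult_right[OF theta3_square_has_sum[OF q2], of 2] has_sum_unique by blast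
qed

text \<open>The geometric mean, by algebra alone: twice the product is the square of the sum minus
  the sum of the squares, and the two preceding identities evaluate both.\<close>

lemma theta3_mult_uminus:
  fixes q :: real assumes "\<bar>q\<bar> < 1"
  shows "theta3 q * theta3 (- q) = (theta3 (- q\<^sup>2))\<^sup>2"
proof -
  have q2: "\<bar>q\<^sup>2\<bar> < 1" using assms by (simp add: abs_square_less_1)
  have "(theta3 q + theta3 (- q))\<^sup>2 = 4 * (theta3 (q ^ 4))\<^sup>2"
    using theta3_add_uminus[OF assms] by (simp add: power_mult_distrib)
  moreover have "(theta3 (q\<^sup>2))\<^sup>2 + (theta3 (- q\<^sup>2))\<^sup>2 = 2 * (theta3 (q ^ 4))\<^sup>2"
    using theta3_square_add_uminus[OF q2] by (simp flip: power_mult)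
  ultimately show ?thesis
    using theta3_square_add_uminus[OF assms] by (simp add: power2_sum)
qed

section \<open>Behaviour of \<open>theta3\<close> near 0, and its size at \<open>q\<close> and
  \<open>- q\<close>\<close>

text \<open>After \<open>1 + 2 * q\<close> the tail is dominated by twice a geometric series
  starting at q^2, whose sum is at most \<open>2 * q^2\<close> because 1 / (1 - |q|) is at most 2.
  Negative \<open>q\<close> is included, as both signs are needed.\<close>

lemma theta3_first_order:
  fixes q :: real assumes "\<bar>q\<bar> \<le> 1 / 2"
  shows "\<bar>theta3 q - 1 - 2 * q\<bar> \<le> 4 * q\<^sup>2"
proof -
  have q: "\<bar>q\<bar> < 1" using assms by simp
  have s: "summable (\<lambda>n. q ^ (Suc n)\<^sup>2)"
    by (rule summable_rabs_cancel[OF summable_square_powers[OF q]])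
  have s': "summable (\<lambda>n. \<bar>q ^ (Suc (Suc n))\<^sup>2\<bar>)"
    using summable_Suc_iff[of "\<lambda>n. \<bar>q ^ (Suc n)\<^sup>2\<bar>"] summable_square_powers[OF q] by blast
  have g: "(\<lambda>n. \<bar>q\<bar> ^ 2 * \<bar>q\<bar> ^ n) sums (\<bar>q\<bar>\<^sup>2 * (1 / (1 - \<bar>q\<bar>)))"
    using q by (intro sums_mult geometric_sums) simp
  have "theta3 q - 1 - 2 * q = 2 * (\<Sum>n. q ^ (Suc (Suc n))\<^sup>2)"
    using suminf_split_head[OF s] theta3_has_sum(2)[OF q] by simp
  moreover have "\<bar>\<Sum>n. q ^ (Suc (Suc n))\<^sup>2\<bar> \<le> (\<Sum>n. \<bar>q ^ (Suc (Suc n))\<^sup>2\<bar>)"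
    by (rule summable_rabs[OF s'])
  moreover have "(\<Sum>n. \<bar>q ^ (Suc (Suc n))\<^sup>2\<bar>) \<le> (\<Sum>n. \<bar>q\<bar> ^ 2 * \<bar>q\<bar> ^ n)"
  proof (rule suminf_le[OF _ s' sums_summable[OF g]])
    fix n
    have "\<bar>q\<bar> ^ (Suc (Suc n))\<^sup>2 \<le> \<bar>q\<bar> ^ (2 + n)"
      using q by (intro power_decreasing) (auto simp: power2_eq_square)
    then show "\<bar>q ^ (Suc (Suc n))\<^sup>2\<bar> \<le> \<bar>q\<bar> ^ 2 * \<bar>q\<bar> ^ n"
      by (simp only: power_add power_abs[symmetric])
  qed
  moreover have "\<bar>q\<bar>\<^sup>2 * (1 / (1 - \<bar>q\<bar>)) \<le> \<bar>q\<bar>\<^sup>2 * 2"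
    using assms by (intro mult_left_mono) (auto simp: field_simps)
  ultimately show ?thesis using sums_unique[OF g] by (simp add: abs_mult)
qed

lemma theta3_ge_1: "theta3 q \<ge> 1" if "0 \<le> q" "q < 1" for q :: real
proof -
  have "summable (\<lambda>n. q ^ (Suc n)\<^sup>2)"
    using summable_rabs_cancel[OF summable_square_powers] that by simp
  then have "(\<Sum>n. q ^ (Suc n)\<^sup>2) \<ge> 0" using that by (intro suminf_nonneg) auto
  then show ?thesis using theta3_has_sum(2)[of q] that by simp
qed

text \<open>Termwise: even exponents cancel in the difference, odd ones contribute a positive
  amount.\<close>

lemma theta3_uminus_less:
  fixes q :: real assumes "0 < q" "q < 1"
  shows "theta3 (- q) < theta3 q"
proof -
  have s: "summable (\<lambda>n. q ^ (Suc n)\<^sup>2)" "summable (\<lambda>n. (- q) ^ (Suc n)\<^sup>2)"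
    using assms by (auto intro!: summable_rabs_cancel summable_square_powers simp del: power_Suc)
  have "0 < (\<Sum>n. q ^ (Suc n)\<^sup>2 - (- q) ^ (Suc n)\<^sup>2)"
  proof (rule suminf_pos2)
    fix n show "0 \<le> q ^ (Suc n)\<^sup>2 - (- q) ^ (Suc n)\<^sup>2"
      using assms by (cases "even ((Suc n)\<^sup>2)") (auto simp: power_minus_odd power_minus_even)
  next show "0 < q ^ (Suc 0)\<^sup>2 - (- q) ^ (Suc 0)\<^sup>2" using assms by simp
  qed (intro summable_diff s)
  then show ?thesis using assms suminf_diff[OF s] by (simp add: theta3_has_sum(2) del: power_Suc)
qed

lemma tendsto_pow_pow2:
  fixes q :: real assumes "\<bar>q\<bar> < 1"
  shows "(\<lambda>n. q ^ (2 ^ n)) \<longlonglongrightarrow> 0"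
  by (rule LIMSEQ_subseq_LIMSEQ[OF LIMSEQ_power_zero, of q "\<lambda>n. 2 ^ n", unfolded o_def])
     (use assms in \<open>auto simp: strict_mono_def\<close>)

lemma theta3_deriv_0: "((\<lambda>q::real. (theta3 q - 1) / q) \<longlongrightarrow> 2) (at 0)"
proof (rule LIM_zero_cancel, rule Lim_null_comparison)
  show "\<forall>\<^sub>F q::real in at 0. norm ((theta3 q - 1) / q - 2) \<le> 4 * \<bar>q\<bar>"
  proof (subst eventually_at, intro exI[of _ "1/2"] conjI ballI impI)
    fix q :: real assume "q \<noteq> 0 \<and> dist q 0 < 1 / 2"
    then have q: "q \<noteq> 0" "\<bar>q\<bar> \<le> 1 / 2" by auto
    have "\<bar>(theta3 q - 1) / q - 2\<bar> = \<bar>theta3 q - 1 - 2 * q\<bar> / \<bar>q\<bar>"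
      using q by (simp add: field_simps flip: abs_divide)
    also have "\<dots> \<le> 4 * q\<^sup>2 / \<bar>q\<bar>" by (intro divide_right_mono theta3_first_order q) simp
    also have "\<dots> = 4 * \<bar>q\<bar>" using q by (simp add: power2_eq_square field_simps)
    finally show "norm ((theta3 q - 1) / q - 2) \<le> 4 * \<bar>q\<bar>" by simp
  qed simp
  show "((\<lambda>q::real. 4 * \<bar>q\<bar>) \<longlongrightarrow> 0) (at 0)" by (auto intro!: tendsto_eq_intros)
qed

lemma theta3_tendsto_1: "(theta3 \<longlongrightarrow> 1) (at (0::real))"
proof -
  have "((\<lambda>q::real. 1 + q * ((theta3 q - 1) / q)) \<longlongrightarrow> 1 + 0 * 2) (at 0)"
    by (intro tendsto_intros theta3_deriv_0)
  moreover have "\<forall>\<^sub>F q::real in at 0. 1 + q * ((theta3 q - 1) / q) = theta3 q"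
    by (subst eventually_at, rule exI[of _ 1]) auto
  ultimately show ?thesis by (simp add: tendsto_cong)
qed

lemma pow_pow2_bounds:
  fixes q :: real assumes "0 < q" "q < 1" shows "0 < q ^ 2 ^ n" "q ^ 2 ^ n < 1"
  using assms by (auto simp: power_less_one_iff)

lemma pow_pow2_Suc: "(q ^ 2 ^ n)\<^sup>2 = q ^ 2 ^ Suc n" for q :: real
  by (simp add: mult.commute flip: power_mult)

text \<open>The product with \<open>theta3 q\<close>, which is at least 1, is a square, so the value
  is nonnegative. A zero would propagate through \<open>theta3_mult_uminus\<close> to all
  \<open>- (q ^ 2 ^ n)\<close>, contradicting the limit 1 at 0.\<close>

lemma theta3_uminus_pos:
  fixes q :: real assumes "0 < q" "q < 1"
  shows "theta3 (- q) > 0"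
proof -
  note pow = pow_pow2_bounds[OF assms]
  have "theta3 (- q) \<ge> 0"
    using theta3_mult_uminus[of q] theta3_ge_1[of q] assms
    by (smt (verit) mult_pos_neg zero_le_power2)
  moreover have "theta3 (- q) \<noteq> 0"
  proof
    assume 0: "theta3 (- q) = 0"
    have z: "theta3 (- (q ^ 2 ^ n)) = 0" for n
    proof (induction n)
      case (Suc n)
      then show ?case using theta3_mult_uminus[of "q ^ 2 ^ n"] pow[of n] unfolding pow_pow2_Suc by simp
    qed (simp add: 0)
    have "filterlim (\<lambda>n. - (q ^ 2 ^ n)) (at 0) sequentially"
      using tendsto_minus[OF tendsto_pow_pow2[of q]] assms pow
      by (intro filterlim_atI) (auto simp: eventually_sequentially less_imp_neq[symmetric])
    then have "(\<lambda>n. theta3 (- (q ^ 2 ^ n))) \<longlonglongrightarrow> 1"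
      by (rule filterlim_compose[OF theta3_tendsto_1])
    then show False by (simp add: z LIMSEQ_const_iff)
  qed
  ultimately show ?thesis by simp
qed

subsection \<open>Landen's transformation\<close>

text \<open>For positive arguments this is Gauss's integral, pi / 2 divided by the
  arithmetic-geometric mean of \<open>a\<close> and \<open>b\<close>. It is the homogeneous form of
  K, with complementary modulus \<open>b / a\<close> when \<open>b <= a\<close>.\<close>

definition gauss_integral :: "real \<Rightarrow> real \<Rightarrow> real" where
  "gauss_integral a b = integral {0..pi / 2} (\<lambda>t. 1 / sqrt (a\<^sup>2 * (cos t)\<^sup>2 + b\<^sup>2 * (sin t)\<^sup>2))"

lemma gauss_form_ge:
  fixes a b t :: real assumes "0 \<le> b" "b \<le> a"
  shows "b\<^sup>2 \<le> a\<^sup>2 * (cos t)\<^sup>2 + b\<^sup>2 * (sin t)\<^sup>2"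
    and "a\<^sup>2 * (cos t)\<^sup>2 + b\<^sup>2 * (sin t)\<^sup>2 \<le> a\<^sup>2"
proof -
  have ab: "b\<^sup>2 \<le> a\<^sup>2" using assms by (simp add: power_mono)
  have "b\<^sup>2 = b\<^sup>2 * (cos t)\<^sup>2 + b\<^sup>2 * (sin t)\<^sup>2" "a\<^sup>2 = a\<^sup>2 * (cos t)\<^sup>2 + a\<^sup>2 * (sin t)\<^sup>2"
    by (simp_all flip: distrib_left)
  then show "b\<^sup>2 \<le> a\<^sup>2 * (cos t)\<^sup>2 + b\<^sup>2 * (sin t)\<^sup>2" "a\<^sup>2 * (cos t)\<^sup>2 + b\<^sup>2 * (sin t)\<^sup>2 \<le> a\<^sup>2"
    using mult_right_mono[OF ab, of "(cos t)\<^sup>2"] mult_right_mono[OF ab, of "(sin t)\<^sup>2"]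
    by auto
qed

lemma gauss_form_pos:
  fixes a b t :: real assumes "0 < a" "0 < b"
  shows "0 < a\<^sup>2 * (cos t)\<^sup>2 + b\<^sup>2 * (sin t)\<^sup>2"
proof (cases "cos t = 0")
  case True
  then have "(sin t)\<^sup>2 = 1" using sin_cos_squared_add[of t] by simp
  then show ?thesis using assms True by simp
qed (use assms in \<open>auto intro!: add_pos_nonneg\<close>)

lemma gauss_integrand_continuous:
  fixes a b :: real assumes "0 < a" "0 < b"
  shows "continuous_on S (\<lambda>t. 1 / sqrt (a\<^sup>2 * (cos t)\<^sup>2 + b\<^sup>2 * (sin t)\<^sup>2))"
  using gauss_form_pos[OF assms] by (auto intro!: continuous_intros simp: less_imp_neq[symmetric])

text \<open>The radicand is a weighted mean of a^2 and b^2. The bounds later squeeze the integral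
  when both arguments tend to 1.\<close>

lemma gauss_integral_bounds:
  assumes "0 < b" "b \<le> a"
  shows "pi / 2 / a \<le> gauss_integral a b" "gauss_integral a b \<le> pi / 2 / b"
proof -
  let ?f = "\<lambda>t. 1 / sqrt (a\<^sup>2 * (cos t)\<^sup>2 + b\<^sup>2 * (sin t)\<^sup>2)"
  have i: "?f integrable_on {0..pi / 2}"
    using assms by (intro integrable_continuous_interval gauss_integrand_continuous) auto
  have "sqrt (b\<^sup>2) \<le> sqrt (a\<^sup>2 * (cos t)\<^sup>2 + b\<^sup>2 * (sin t)\<^sup>2)"
       "sqrt (a\<^sup>2 * (cos t)\<^sup>2 + b\<^sup>2 * (sin t)\<^sup>2) \<le> sqrt (a\<^sup>2)" for t
    using assms by (simp_all only: real_sqrt_le_iff gauss_form_ge less_imp_le)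
  then have *: "1 / a \<le> ?f t" "?f t \<le> 1 / b" for t
    using assms gauss_form_pos[of a b t] by (auto intro!: divide_left_mono)
  have "integral {0..pi / 2} (\<lambda>_. 1 / a) \<le> gauss_integral a b"
    unfolding gauss_integral_def by (rule integral_le) (use i * in auto)
  then show "pi / 2 / a \<le> gauss_integral a b" by simp
  have "gauss_integral a b \<le> integral {0..pi / 2} (\<lambda>_. 1 / b)"
    unfolding gauss_integral_def by (rule integral_le) (use i * in auto)
  then show "gauss_integral a b \<le> pi / 2 / b" by simp
qed

lemma gauss_integral_scale:
  assumes "c > 0" shows "gauss_integral (c * a) (c * b) = gauss_integral a b / c"
proof -
  have "(c * a)\<^sup>2 * (cos t)\<^sup>2 + (c * b)\<^sup>2 * (sin t)\<^sup>2 = c\<^sup>2 * (a\<^sup>2 * (cos t)\<^sup>2 + b\<^sup>2 * (sin t)\<^sup>2)" for t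
    by (simp add: algebra_simps power2_eq_square)
  then have "1 / sqrt ((c * a)\<^sup>2 * (cos t)\<^sup>2 + (c * b)\<^sup>2 * (sin t)\<^sup>2) =
      1 / sqrt (a\<^sup>2 * (cos t)\<^sup>2 + b\<^sup>2 * (sin t)\<^sup>2) / c" for t
    using assms by (simp add: real_sqrt_mult)
  then show ?thesis by (simp only: gauss_integral_def integral_divide)
qed

lemma integral_reflect_interval:
  fixes f :: "real \<Rightarrow> real"
  assumes "0 \<le> c" "continuous_on {0..c} f"
  shows "integral {0..c} (\<lambda>x. f (c - x)) = integral {0..c} f"
proof -
  have "((\<lambda>x. (-1) *\<^sub>R f (c - x)) has_integral (integral {c - 0..c - c} f - integral {c - c..c - 0} f)) {0..c}"
    by (rule has_integral_substitution_general[of "{}"])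
       (use assms in \<open>auto intro!: continuous_intros derivative_eq_intros\<close>)
  then have "((\<lambda>x. - f (c - x)) has_integral (- integral {0..c} f)) {0..c}"
    using assms by (cases "c = 0") auto
  then show ?thesis by (simp add: has_integral_neg_iff integral_unique)
qed

text \<open>The integrand is symmetric about pi / 2. The doubled interval appears because Landen's
  angle runs up to pi while \<open>t\<close> runs up to pi / 2.\<close>

lemma gauss_integral_full:
  assumes "0 < a" "0 < b"
  shows "integral {0..pi} (\<lambda>t. 1 / sqrt (a\<^sup>2 * (cos t)\<^sup>2 + b\<^sup>2 * (sin t)\<^sup>2)) = 2 * gauss_integral a b"
proof -
  let ?f = "\<lambda>t. 1 / sqrt (a\<^sup>2 * (cos t)\<^sup>2 + b\<^sup>2 * (sin t)\<^sup>2)"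
  have cont: "continuous_on S ?f" for S by (rule gauss_integrand_continuous[OF assms])
  have "((\<lambda>x. (-1) *\<^sub>R ?f (pi - x)) has_integral (integral {pi - 0..pi - pi / 2} ?f - integral {pi - pi / 2..pi - 0} ?f)) {0..pi / 2}"
    by (rule has_integral_substitution_general[of "{}" _ _ _ 0 pi])
       (auto intro!: cont continuous_intros derivative_eq_intros)
  then have "((\<lambda>x. - ?f x) has_integral (- integral {pi / 2..pi} ?f)) {0..pi / 2}"
    by (simp add: sin_diff cos_diff)
  then have "integral {pi / 2..pi} ?f = gauss_integral a b"
    by (simp add: has_integral_neg_iff integral_unique gauss_integral_def)
  moreover have "integral {0..pi / 2} ?f + integral {pi / 2..pi} ?f = integral {0..pi} ?f"
    by (rule Henstock_Kurzweil_Integration.integral_combine) (auto intro!: integrable_continuous_interval cont)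
  ultimately show ?thesis by (simp add: gauss_integral_def)
qed

text \<open>The algebra of Landen's substitution, with \<open>s\<close>, \<open>c\<close> for sine
  and cosine of \<open>t\<close>. The first and third identities determine the sine of the new
  angle; the first, fourth, fifth and second simplify its derivative.\<close>

lemma landen_identities:
  fixes a b s c :: real
  assumes "s\<^sup>2 + c\<^sup>2 = 1"
  shows "(a * c\<^sup>2 + b * s\<^sup>2)\<^sup>2 + ((a - b) * (s * c))\<^sup>2 = a\<^sup>2 * c\<^sup>2 + b\<^sup>2 * s\<^sup>2"
    and "a\<^sup>2 * c\<^sup>2 + b\<^sup>2 * s\<^sup>2 + a * b = (a + b) * (a * c\<^sup>2 + b * s\<^sup>2)"
    and "2 * (s * c) * (a * c\<^sup>2 + b * s\<^sup>2) - (c\<^sup>2 - s\<^sup>2) * ((a - b) * (s * c)) = (a + b) * (s * c)"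
    and "(c\<^sup>2 - s\<^sup>2) * (a * c\<^sup>2 + b * s\<^sup>2) - (s * c) * (2 * (b - a) * (s * c)) = a * c\<^sup>2 - b * s\<^sup>2"
    and "2 * (a\<^sup>2 * c\<^sup>2 + b\<^sup>2 * s\<^sup>2) - (a - b) * (a * c\<^sup>2 - b * s\<^sup>2) = a\<^sup>2 * c\<^sup>2 + b\<^sup>2 * s\<^sup>2 + a * b"
  using assms by algebra+

text \<open>Landen's substitution \<open>\<phi> = t + arctan (b / a * tan t)\<close>, rewritten so that it is smooth at
  \<open>t = \<pi> / 2\<close>; it maps \<open>[0, \<pi> / 2]\<close> onto \<open>[0, \<pi>]\<close>.\<close>

definition landen_angle :: "real \<Rightarrow> real \<Rightarrow> real \<Rightarrow> real" where
  "landen_angle a b t =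
     2 * t - arctan ((a - b) * (sin t * cos t) / (a * (cos t)\<^sup>2 + b * (sin t)\<^sup>2))"

lemma landen_denom_pos:
  fixes a b t :: real assumes "0 < a" "0 < b"
  shows "0 < a * (cos t)\<^sup>2 + b * (sin t)\<^sup>2"
  using gauss_form_pos[of "sqrt a" "sqrt b" t] assms by simp

lemma landen_angle_deriv:
  fixes a b t :: real assumes ab: "0 < a" "0 < b"
  shows "(landen_angle a b has_field_derivative
      (a + b) * (a * (cos t)\<^sup>2 + b * (sin t)\<^sup>2) / (a\<^sup>2 * (cos t)\<^sup>2 + b\<^sup>2 * (sin t)\<^sup>2)) (at t within S)"
proof -
  define s c where "s = sin t" and "c = cos t"
  have sc: "s\<^sup>2 + c\<^sup>2 = 1" by (simp add: s_def c_def)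
  define D E where "D = a * c\<^sup>2 + b * s\<^sup>2" and "E = a\<^sup>2 * c\<^sup>2 + b\<^sup>2 * s\<^sup>2"
  have D: "D > 0" using landen_denom_pos[OF ab, of t] by (simp add: D_def s_def c_def)
  have E: "E > 0" using gauss_form_pos[OF ab, of t] by (simp add: E_def s_def c_def)
  note id = landen_identities[OF sc, of a b, folded D_def E_def]
  have w: "((\<lambda>t. (a - b) * (sin t * cos t) / (a * (cos t)\<^sup>2 + b * (sin t)\<^sup>2)) has_field_derivative
      ((a - b) * (c\<^sup>2 - s\<^sup>2) * D - (a - b) * (s * c) * (2 * (b - a) * (s * c))) / (D * D)) (at t within S)"
  proof -
    have "((\<lambda>t. (a - b) * (sin t * cos t)) has_field_derivative (a - b) * (c\<^sup>2 - s\<^sup>2)) (at t within S)"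
      by (auto intro!: derivative_eq_intros simp: s_def c_def algebra_simps power2_eq_square)
    moreover have "((\<lambda>t. a * (cos t)\<^sup>2 + b * (sin t)\<^sup>2) has_field_derivative 2 * (b - a) * (s * c)) (at t within S)"
      by (auto intro!: derivative_eq_intros simp: s_def c_def algebra_simps power2_eq_square)
    ultimately show ?thesis
      using DERIV_divide[of _ _ t S] D by (fastforce simp: D_def s_def c_def)
  qed
  have d: "(landen_angle a b has_field_derivative (2 - 1 / (1 + ((a - b) * (s * c) / D)\<^sup>2) *
      (((a - b) * (c\<^sup>2 - s\<^sup>2) * D - (a - b) * (s * c) * (2 * (b - a) * (s * c))) / (D * D)))) (at t within S)"
    unfolding landen_angle_def[abs_def]
    by (rule derivative_eq_intros w refl)+ (simp add: D_def s_def c_def inverse_eq_divide)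
  \<comment> \<open>\<open>h1\<close> is the numerator of the derivative of the arctangent's
    argument and \<open>h2\<close> is one plus the square of that argument; the powers of
    \<open>D\<close> cancel and \<open>h3\<close> leaves one fraction over \<open>E\<close>.\<close>
  have h1: "(a - b) * (c\<^sup>2 - s\<^sup>2) * D - (a - b) * (s * c) * (2 * (b - a) * (s * c)) = (a - b) * (a * c\<^sup>2 - b * s\<^sup>2)"
    unfolding id(4)[symmetric] by (simp add: algebra_simps)
  have h2: "1 + ((a - b) * (s * c) / D)\<^sup>2 = E / (D * D)"
    unfolding id(1)[symmetric] using D by (simp add: field_simps power2_eq_square)
  have h3: "2 - 1 / (E / (D * D)) * ((a - b) * (a * c\<^sup>2 - b * s\<^sup>2) / (D * D)) = (2 * E - (a - b) * (a * c\<^sup>2 - b * s\<^sup>2)) / E"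
    using D E by (simp add: field_simps)
  show ?thesis
    using d unfolding h1 h2 h3 id(5) id(2) unfolding D_def E_def s_def c_def .
qed

lemma landen_angle_form:
  fixes a b t :: real assumes ab: "0 < a" "0 < b"
  shows "((a + b) / 2)\<^sup>2 * (cos (landen_angle a b t))\<^sup>2 + (sqrt (a * b))\<^sup>2 * (sin (landen_angle a b t))\<^sup>2 =
     ((a + b) / 2 * (a * (cos t)\<^sup>2 + b * (sin t)\<^sup>2))\<^sup>2 / (a\<^sup>2 * (cos t)\<^sup>2 + b\<^sup>2 * (sin t)\<^sup>2)"
proof -
  define s c where "s = sin t" and "c = cos t"
  have sc: "s\<^sup>2 + c\<^sup>2 = 1" by (simp add: s_def c_def)
  define D E where "D = a * c\<^sup>2 + b * s\<^sup>2" and "E = a\<^sup>2 * c\<^sup>2 + b\<^sup>2 * s\<^sup>2"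
  have D: "D > 0" using landen_denom_pos[OF ab, of t] by (simp add: D_def s_def c_def)
  have E: "E > 0" using gauss_form_pos[OF ab, of t] by (simp add: E_def s_def c_def)
  note id = landen_identities[OF sc, of a b, folded D_def E_def]
  define w where "w = (a - b) * (s * c) / D"
  define S where "S = (sin (landen_angle a b t))\<^sup>2"
  have w1: "1 + w\<^sup>2 = E / D\<^sup>2"
    unfolding id(1)[symmetric] w_def using D by (simp add: field_simps power2_eq_square)
  have "sin (landen_angle a b t) = (2 * (s * c) - (c\<^sup>2 - s\<^sup>2) * w) / sqrt (1 + w\<^sup>2)"
    by (simp add: landen_angle_def sin_diff sin_arctan cos_arctan sin_double cos_double w_def D_def s_def c_def
          diff_divide_distrib)
  also have "2 * (s * c) - (c\<^sup>2 - s\<^sup>2) * w = (2 * (s * c) * D - (c\<^sup>2 - s\<^sup>2) * ((a - b) * (s * c))) / D"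
    using D by (simp add: w_def diff_divide_distrib)
  finally have "S = ((a + b) * (s * c) / D)\<^sup>2 / (1 + w\<^sup>2)"
    unfolding id(3) S_def by (simp add: power_divide power_mult_distrib add_nonneg_nonneg)
  then have S: "S = (a + b)\<^sup>2 * (s * c)\<^sup>2 / E"
    unfolding w1 using D by (simp add: power_divide power_mult_distrib)
  have "((a + b) / 2)\<^sup>2 * (cos (landen_angle a b t))\<^sup>2 + (sqrt (a * b))\<^sup>2 * (sin (landen_angle a b t))\<^sup>2
      = ((a + b) / 2)\<^sup>2 * (1 - S) + a * b * S"
    using ab by (simp add: S_def cos_squared_eq)
  \<comment> \<open>The squares of the arithmetic and the geometric mean differ by ((a - b) /
    2)^2.\<close>
  also have "\<dots> = ((a + b) / 2)\<^sup>2 - ((a - b) / 2)\<^sup>2 * S"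
    by (simp add: field_simps power2_eq_square)
  also have "\<dots> = ((a + b) / 2)\<^sup>2 * ((E - ((a - b) * (s * c))\<^sup>2) / E)"
    using E by (simp add: S field_simps power2_eq_square)
  also have "E - ((a - b) * (s * c))\<^sup>2 = D\<^sup>2" using id(1) by simp
  finally show ?thesis unfolding power_mult_distrib D_def E_def s_def c_def by (simp only: times_divide_eq_right)
qed

text \<open>Under Landen's substitution the factor \<open>?D t\<close> of the derivative cancels
  against the new integrand, leaving twice the old integrand. The new integral over [0, pi] is also
  twice a Gauss integral.\<close>

lemma gauss_integral_landen:
  assumes ab: "0 < a" "0 < b"
  shows "gauss_integral a b = gauss_integral ((a + b) / 2) (sqrt (a * b))"
proof -
  let ?A = "(a + b) / 2" and ?G = "sqrt (a * b)"
  let ?f = "\<lambda>t. 1 / sqrt (?A\<^sup>2 * (cos t)\<^sup>2 + ?G\<^sup>2 * (sin t)\<^sup>2)"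
  let ?D = "\<lambda>t. a * (cos t)\<^sup>2 + b * (sin t)\<^sup>2" and ?E = "\<lambda>t. a\<^sup>2 * (cos t)\<^sup>2 + b\<^sup>2 * (sin t)\<^sup>2"
  have AG: "?A > 0" "?G > 0" using ab by auto
  have ends: "landen_angle a b 0 = 0" "landen_angle a b (pi / 2) = pi"
    by (simp_all add: landen_angle_def)
  \<comment> \<open>A crude enclosing interval, from the bound pi / 2 on the arctangent; the exact
    limits of integration come from \<open>ends\<close>.\<close>
  have sub: "landen_angle a b t \<in> {- pi..2 * pi}" if "t \<in> {0..pi / 2}" for t
    using that arctan_bounded[of "(a - b) * (sin t * cos t) / ?D t"]
    by (auto simp: landen_angle_def)
  have "((\<lambda>t. ((a + b) * ?D t / ?E t) *\<^sub>R ?f (landen_angle a b t)) has_integral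
      integral {landen_angle a b 0..landen_angle a b (pi / 2)} ?f) {0..pi / 2}"
    by (rule has_integral_substitution[where c = "- pi" and d = "2 * pi"])
       (use ends sub in \<open>auto intro!: gauss_integrand_continuous[OF AG] landen_angle_deriv[OF ab]\<close>)
  moreover have "((a + b) * ?D t / ?E t) *\<^sub>R ?f (landen_angle a b t) = 2 * (1 / sqrt (?E t))" for t
  proof -
    have "sqrt (?A\<^sup>2 * (cos (landen_angle a b t))\<^sup>2 + ?G\<^sup>2 * (sin (landen_angle a b t))\<^sup>2) = ?A * ?D t / sqrt (?E t)"
      unfolding landen_angle_form[OF ab] real_sqrt_divide real_sqrt_abs
      using landen_denom_pos[OF ab, of t] ab by (simp add: abs_mult)
    note eq = this
    \<comment> \<open>With \<open>?E t\<close> written as \<open>r * r\<close>, a rational identity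
      remains.\<close>
    define r where "r = sqrt (?E t)"
    have r: "?E t = r * r" "r > 0" using gauss_form_pos[OF ab, of t] by (simp_all add: r_def)
    show ?thesis
      unfolding eq real_scaleR_def r_def[symmetric] unfolding r(1)
      using landen_denom_pos[OF ab, of t] r(2) ab by (simp add: divide_simps)
  qed
  ultimately have "((\<lambda>t. 2 * (1 / sqrt (?E t))) has_integral (2 * gauss_integral ?A ?G)) {0..pi / 2}"
    by (simp only: ends gauss_integral_full[OF AG])
  then have "integral {0..pi / 2} (\<lambda>t. 2 * (1 / sqrt (?E t))) = 2 * gauss_integral ?A ?G"
    by (rule integral_unique)
  then show ?thesis unfolding integral_mult_right gauss_integral_def by simp
qed

section \<open>The elliptic integral in Gauss's form; ascending transformation and logarithmic
  bounds\<close>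

lemma elliptic_K_eq_gauss:
  assumes "\<bar>x\<bar> \<le> 1" shows "elliptic_K x = gauss_integral 1 (sqrt (1 - x\<^sup>2))"
proof -
  have "x\<^sup>2 \<le> 1" using assms by (simp add: abs_square_le_1)
  then have "1 - x\<^sup>2 * (sin t)\<^sup>2 = 1\<^sup>2 * (cos t)\<^sup>2 + (sqrt (1 - x\<^sup>2))\<^sup>2 * (sin t)\<^sup>2" for t
    by (simp add: cos_squared_eq algebra_simps)
  then show ?thesis by (simp only: elliptic_K_def gauss_integral_def)
qed

lemma gauss_integral_eq_elliptic_K:
  assumes "0 < b" "b \<le> a" shows "gauss_integral a b = elliptic_K (sqrt (1 - (b / a)\<^sup>2)) / a"
proof -
  have ba: "0 \<le> b / a" "b / a \<le> 1" using assms by auto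
  then have "(b / a)\<^sup>2 \<le> 1" by (simp add: power_le_one)
  then have "elliptic_K (sqrt (1 - (b / a)\<^sup>2)) = gauss_integral 1 (b / a)"
    using elliptic_K_eq_gauss[of "sqrt (1 - (b / a)\<^sup>2)"] ba assms by simp
  then show ?thesis using gauss_integral_scale[of a 1 "b / a"] assms by simp
qed

text \<open>The new modulus has complementary modulus (1 - x) / (1 + x). Homogeneity clears the
  denominator, and one mean step takes \<open>1 + x\<close>, \<open>1 - x\<close> to
  \<open>1\<close>, \<open>sqrt (1 - x^2)\<close>.\<close>

lemma elliptic_K_ascending:
  assumes x: "0 < x" "x < 1"
  shows "elliptic_K (2 * sqrt x / (1 + x)) = (1 + x) * elliptic_K x"
proof -
  have sq: "1 - (2 * sqrt x / (1 + x))\<^sup>2 = ((1 - x) / (1 + x))\<^sup>2"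
  proof -
    have "1 - 4 * x / (1 + x)\<^sup>2 = ((1 + x)\<^sup>2 - 4 * x) / (1 + x)\<^sup>2"
      using x by (simp add: diff_divide_distrib)
    also have "(1 + x)\<^sup>2 - 4 * x = (1 - x)\<^sup>2" by algebra
    finally show ?thesis using x by (simp add: power_divide power_mult_distrib)
  qed
  have "(2 * sqrt x / (1 + x))\<^sup>2 \<le> 1" using sq by (smt (verit) zero_le_power2)
  then have "\<bar>2 * sqrt x / (1 + x)\<bar> \<le> 1" by (simp add: abs_square_le_1)
  then have "elliptic_K (2 * sqrt x / (1 + x)) = gauss_integral 1 ((1 - x) / (1 + x))"
    unfolding elliptic_K_eq_gauss[OF \<open>\<bar>2 * sqrt x / (1 + x)\<bar> \<le> 1\<close>] sq using x by simp
  also have "\<dots> = (1 + x) * gauss_integral (1 + x) (1 - x)"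
    using gauss_integral_scale[of "1 + x" 1 "(1 - x) / (1 + x)"] x by simp
  also have "gauss_integral (1 + x) (1 - x) = gauss_integral 1 (sqrt (1 - x\<^sup>2))"
  proof -
    have "(1 + x) * (1 - x) = 1 - x\<^sup>2" by (simp add: algebra_simps power2_eq_square)
    then show ?thesis using gauss_integral_landen[of "1 + x" "1 - x"] x by simp
  qed
  also have "\<dots> = elliptic_K x" using elliptic_K_eq_gauss[of x] x by simp
  finally show ?thesis .
qed

text \<open>The bounds are \<open>K(x)\<close> with \<open>\<theta>\<close> reflected and the numerator \<open>1\<close> replaced by \<open>cos \<theta>\<close>, which
  makes the integral elementary, at a cost of at most \<open>\<pi> / 2\<close>.\<close>

lemma elliptic_K_log_bounds:
  assumes x: "0 < x" "x < 1"
  shows "(ln (1 + x) - ln (sqrt (1 - x\<^sup>2))) / x \<le> elliptic_K x"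
    and "elliptic_K x \<le> (ln (1 + x) - ln (sqrt (1 - x\<^sup>2))) / x + pi / 2"
proof -
  define S where "S = (\<lambda>t. sqrt (1 - x\<^sup>2 + x\<^sup>2 * (sin t)\<^sup>2))"
  define L where "L = (ln (1 + x) - ln (sqrt (1 - x\<^sup>2))) / x"
  have x2: "x\<^sup>2 < 1" using x by (simp add: power_less_one_iff)
  have rad: "1 - x\<^sup>2 + x\<^sup>2 * (sin t)\<^sup>2 > 0" for t using x2 by (simp add: add_pos_nonneg)
  have S: "S t > 0" for t using rad by (simp add: S_def)
  have contS: "continuous_on T S" for T unfolding S_def by (intro continuous_intros)
  have cont1: "continuous_on {0..pi / 2} (\<lambda>t. 1 / S t)"
    using S by (auto intro!: continuous_intros contS simp: less_imp_neq[symmetric])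
  have "1 - x\<^sup>2 * (sin (pi / 2 - t))\<^sup>2 = 1 - x\<^sup>2 + x\<^sup>2 * (sin t)\<^sup>2" for t
    by (simp add: sin_diff cos_squared_eq algebra_simps)
  then have eq: "1 / sqrt (1 - x\<^sup>2 * (sin (pi / 2 - t))\<^sup>2) = 1 / S t" for t by (simp add: S_def)
  have "continuous_on {0..pi / 2} (\<lambda>t. 1 / sqrt (1 - x\<^sup>2 * (sin t)\<^sup>2))"
  proof -
    have "x\<^sup>2 * (sin t)\<^sup>2 \<le> x\<^sup>2 * 1" for t by (intro mult_left_mono) (auto simp: abs_square_le_1)
    then have "1 - x\<^sup>2 * (sin t)\<^sup>2 \<noteq> 0" for t using x2 by (smt (verit))
    then show ?thesis by (auto intro!: continuous_intros)
  qed
  from integral_reflect_interval[OF _ this] have K: "elliptic_K x = integral {0..pi / 2} (\<lambda>t. 1 / S t)"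
    unfolding eq by (simp add: elliptic_K_def)
  \<comment> \<open>With u = x sin t, the integrand \<open>cos t / S t\<close> becomes 1 / (x sqrt
    (1 - x^2 + u^2)), which has a logarithmic primitive.\<close>
  let ?F = "\<lambda>t. ln (x * sin t + S t) / x"
  have "((\<lambda>t. cos t / S t) has_integral (?F (pi / 2) - ?F 0)) {0..pi / 2}"
  proof (rule fundamental_theorem_of_calculus)
    fix t :: real assume t: "t \<in> {0..pi / 2}"
    have st: "sin t \<ge> 0" using t by (intro sin_ge_zero) auto
    then have p: "x * sin t + S t > 0" using x S by (intro add_nonneg_pos) auto
    have dS: "(S has_field_derivative (x\<^sup>2 * (sin t * cos t) / S t)) (at t within {0..pi / 2})"
      unfolding S_def using rad[of t]
      by (auto intro!: derivative_eq_intros simp: field_simps)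
    have "(?F has_field_derivative (x * cos t + x\<^sup>2 * (sin t * cos t) / S t) / (x * sin t + S t) / x) (at t within {0..pi / 2})"
      using p x by (auto intro!: derivative_eq_intros dS)
    moreover have "x * cos t + x\<^sup>2 * (sin t * cos t) / S t = x * (cos t / S t) * (x * sin t + S t)"
      using S[of t] by (simp add: field_simps power2_eq_square)
    ultimately show "(?F has_vector_derivative cos t / S t) (at t within {0..pi / 2})"
      using p x by (simp add: has_real_derivative_iff_has_vector_derivative)
  qed simp
  moreover have "?F (pi / 2) - ?F 0 = L" by (simp add: S_def L_def diff_divide_distrib add.commute)
  ultimately have C: "((\<lambda>t. cos t / S t) has_integral L) {0..pi / 2}" by simp
  have I1: "((\<lambda>t. 1 / S t) has_integral elliptic_K x) {0..pi / 2}"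
    unfolding K by (intro integrable_integral integrable_continuous_interval cont1)
  have "L \<le> elliptic_K x"
    by (rule has_integral_le[OF C I1]) (use S in \<open>auto intro!: divide_right_mono simp: less_imp_le\<close>)
  then show "(ln (1 + x) - ln (sqrt (1 - x\<^sup>2))) / x \<le> elliptic_K x" by (simp add: L_def)
  have "elliptic_K x \<le> L + 1 * (pi / 2)"
  proof (rule has_integral_le[OF I1])
    show "((\<lambda>t. cos t / S t + 1) has_integral (L + 1 * (pi / 2))) {0..pi / 2}"
      by (intro has_integral_add C) (use has_integral_const_real[of "1::real" 0 "pi / 2"] in simp)
    fix t :: real assume t: "t \<in> {0..pi / 2}"
    have ct: "0 \<le> cos t" using t by (intro cos_ge_zero) auto
    \<comment> \<open>Aims at \<open>1 - cos t <= S t\<close>: replacing the numerator then changes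
      the integrand by at most 1, hence the integral by at most pi / 2.\<close>
    have "(1 - cos t)\<^sup>2 \<le> (sin t)\<^sup>2"
      using ct mult_left_mono[of "cos t" 1 "cos t"] unfolding sin_squared_eq by (simp add: power2_eq_square algebra_simps)
    also have "\<dots> \<le> 1 - x\<^sup>2 + x\<^sup>2 * (sin t)\<^sup>2"
    proof -
      have "(1 - x\<^sup>2) * (sin t)\<^sup>2 \<le> (1 - x\<^sup>2) * 1"
        using x by (intro mult_left_mono) (auto simp: abs_square_le_1)
      then show ?thesis by (simp add: algebra_simps)
    qed
    finally have "1 - cos t \<le> S t" unfolding S_def by (rule real_le_rsqrt)
    then show "1 / S t \<le> cos t / S t + 1" using S[of t] by (simp add: field_simps)
  qed
  then show "elliptic_K x \<le> (ln (1 + x) - ln (sqrt (1 - x\<^sup>2))) / x + pi / 2" by (simp add: L_def)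
qed

subsection \<open>Hypergeometric series\<close>

lemma pochhammer_half_ratio:
  "pochhammer (1 / 2) (Suc n) / fact (Suc n) = (2 * real n + 1) / (2 * real n + 2) * (pochhammer (1 / 2) n / fact n :: real)"
  by (simp add: pochhammer_Suc field_simps)

lemma pochhammer_half_bounds:
  "0 < (pochhammer (1 / 2) n / fact n :: real)" "(pochhammer (1 / 2) n / fact n :: real) \<le> 1"
proof -
  show p: "0 < (pochhammer (1 / 2) n / fact n :: real)" for n by (simp add: pochhammer_pos)
  show "(pochhammer (1 / 2) n / fact n :: real) \<le> 1"
  proof (induction n)
    case (Suc n)
    then show ?case unfolding pochhammer_half_ratio using p[of n]
      by (intro mult_le_one) auto
  qed simp
qed

text \<open>The binomial series with exponent -1/2; the sign of the binomial coefficient cancels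
  that of \<open>(- z) ^ n\<close>.\<close>

lemma inverse_sqrt_series:
  fixes z :: real assumes "\<bar>z\<bar> < 1"
  shows "(\<lambda>n. pochhammer (1 / 2) n / fact n * z ^ n) sums (1 / sqrt (1 - z))"
proof -
  have "(\<lambda>n. ((- 1 / 2) gchoose n) * (- z) ^ n) sums (1 + - z) powr (- 1 / 2)"
    by (rule gen_binomial_real) (use assms in simp)
  moreover have "((- 1 / 2) gchoose n) * (- z) ^ n = pochhammer (1 / 2) n / fact n * z ^ n" for n
  proof -
    have "((- 1 / 2) gchoose n) * (- z) ^ n = ((- 1) ^ n * (- 1) ^ n) * (pochhammer (1 / 2) n / fact n * z ^ n)"
      unfolding gbinomial_pochhammer power_minus[of z n] by simp
    also have "(- 1) ^ n * (- 1) ^ n = (1 :: real)" by (simp flip: power_mult_distrib)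
    finally show ?thesis by simp
  qed
  moreover have "(1 + - z) powr (- 1 / 2) = 1 / sqrt (1 - z)"
    using assms by (simp add: powr_minus_divide powr_half_sqrt)
  ultimately show ?thesis by simp
qed

text \<open>Wallis's recurrence: the primitive \<open>?F\<close> vanishes at both endpoints, and its
  derivative combines two consecutive even powers of the sine.\<close>

lemma wallis_has_integral:
  "((\<lambda>t. (sin t) ^ (2 * n)) has_integral (pi / 2 * (pochhammer (1 / 2) n / fact n))) {0..pi / 2}"
proof (induction n)
  case 0
  show ?case using has_integral_const_real[of "1::real" 0 "pi / 2"] by simp
next
  case (Suc n)
  let ?F = "\<lambda>t::real. - ((sin t) ^ (2 * n + 1) * cos t)"
  have "((\<lambda>t. (2 * n + 2) * (sin t) ^ (2 * Suc n) - (2 * n + 1) * (sin t) ^ (2 * n)) has_integral (?F (pi / 2) - ?F 0)) {0..pi / 2}"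
  proof (rule fundamental_theorem_of_calculus)
    fix t :: real
    have "(?F has_field_derivative (- ((2 * n + 1) * (sin t) ^ (2 * n) * (cos t)\<^sup>2 - (sin t) ^ (2 * n + 2)))) (at t within {0..pi / 2})"
    proof -
      have "((\<lambda>t. (sin t) ^ Suc (2 * n)) has_field_derivative (1 + real (2 * n)) * (cos t * (sin t) ^ (2 * n))) (at t within {0..pi / 2})"
        by (intro DERIV_power_Suc) (auto intro!: derivative_eq_intros)
      moreover have "(cos has_field_derivative - sin t) (at t within {0..pi / 2})"
        by (auto intro!: derivative_eq_intros)
      ultimately show ?thesis
        using DERIV_minus[OF DERIV_mult] by (fastforce simp: algebra_simps power2_eq_square)
    qed
    moreover have "- ((2 * n + 1) * (sin t) ^ (2 * n) * (cos t)\<^sup>2 - (sin t) ^ (2 * n + 2)) = (2 * n + 2) * (sin t) ^ (2 * Suc n) - (2 * n + 1) * (sin t) ^ (2 * n)"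
      unfolding cos_squared_eq by (simp add: algebra_simps power2_eq_square)
    ultimately show "(?F has_vector_derivative ((2 * n + 2) * (sin t) ^ (2 * Suc n) - (2 * n + 1) * (sin t) ^ (2 * n))) (at t within {0..pi / 2})"
      by (simp add: has_real_derivative_iff_has_vector_derivative)
  qed simp
  from has_integral_add[OF this has_integral_mult_right[OF Suc, of "2 * n + 1"]]
  have "((\<lambda>t. (2 * n + 2) * (sin t) ^ (2 * Suc n)) has_integral ((2 * n + 1) * (pi / 2 * (pochhammer (1 / 2) n / fact n)))) {0..pi / 2}"
    by simp
  from has_integral_mult_right[OF this, of "1 / (2 * n + 2)"]
  have "((\<lambda>t. (sin t) ^ (2 * Suc n)) has_integral (1 / (2 * n + 2) * ((2 * n + 1) * (pi / 2 * (pochhammer (1 / 2) n / fact n))))) {0..pi / 2}"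
    by (simp add: mult.assoc[symmetric] del: mult_Suc_right power_Suc)
  moreover have "1 / (2 * n + 2) * ((2 * n + 1) * (pi / 2 * (pochhammer (1 / 2) n / fact n))) = pi / 2 * (pochhammer (1 / 2) (Suc n) / fact (Suc n))"
    unfolding pochhammer_half_ratio by (simp add: add_ac mult_ac)
  ultimately show ?case by simp
qed

text \<open>Binomial expansion integrated term by term, with the majorant
  \<open>c n * (x^2) ^ n\<close>. The coefficient is squared because one factor comes from the
  binomial series and one from Wallis's integral.\<close>

lemma elliptic_K_series:
  assumes "\<bar>x\<bar> < 1"
  shows "(\<lambda>n. pi / 2 * (pochhammer (1 / 2) n / fact n)\<^sup>2 * x ^ (2 * n)) sums elliptic_K x"
proof -
  define c where "c = (\<lambda>n. pochhammer (1 / 2) n / fact n :: real)"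
  define f where "f = (\<lambda>n t. c n * (x\<^sup>2 * (sin t)\<^sup>2) ^ n)"
  have c: "c n > 0" for n by (simp add: c_def pochhammer_half_bounds)
  have x2: "\<bar>x\<^sup>2\<bar> < 1" using assms by (simp add: abs_square_less_1)
  have xs: "x\<^sup>2 * (sin t)\<^sup>2 \<le> x\<^sup>2" for t
    using mult_left_mono[of "(sin t)\<^sup>2" 1 "x\<^sup>2"] by (simp add: abs_square_le_1)
  have xs1: "\<bar>x\<^sup>2 * (sin t)\<^sup>2\<bar> < 1" for t
    using x2 xs[of t] by (simp add: abs_mult)
  have sm: "summable (\<lambda>n. c n * (x\<^sup>2) ^ n)"
    using inverse_sqrt_series[OF x2] by (simp add: c_def sums_iff)
  have "uniform_limit {0..pi / 2} (\<lambda>n t. \<Sum>i<n. f i t) (\<lambda>t. suminf (\<lambda>i. f i t)) sequentially"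
  proof (rule Weierstrass_m_test[OF _ sm])
    fix n t show "norm (f n t) \<le> c n * (x\<^sup>2) ^ n"
      using xs[of t] c[of n] by (auto simp: f_def abs_mult power_abs[symmetric] intro!: mult_left_mono power_mono)
  qed
  moreover have "continuous_on {0..pi / 2} (\<lambda>t. \<Sum>i<n. f i t)" for n
    unfolding f_def by (intro continuous_intros)
  ultimately obtain I J where I: "\<And>n. ((\<lambda>t. \<Sum>i<n. f i t) has_integral I n) {0..pi / 2}"
    and J: "((\<lambda>t. suminf (\<lambda>i. f i t)) has_integral J) {0..pi / 2}" and lim: "I \<longlonglongrightarrow> J"
    by (rule uniform_limit_integral) auto
  have "suminf (\<lambda>i. f i t) = 1 / sqrt (1 - x\<^sup>2 * (sin t)\<^sup>2)" for t
    using inverse_sqrt_series[OF xs1[of t]] by (simp add: f_def c_def sums_iff)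
  then have "J = elliptic_K x" using J by (simp add: elliptic_K_def integral_unique)
  moreover
  have "I n = (\<Sum>i<n. pi / 2 * (c i)\<^sup>2 * x ^ (2 * i))" for n
  proof -
    have "(f i has_integral (c i * x ^ (2 * i)) * (pi / 2 * c i)) {0..pi / 2}" for i
      using has_integral_mult_right[OF wallis_has_integral[of i], of "c i * x ^ (2 * i)"]
      by (simp add: f_def c_def power_mult_distrib mult.assoc flip: power_mult)
    then have "((\<lambda>t. \<Sum>i<n. f i t) has_integral (\<Sum>i<n. (c i * x ^ (2 * i)) * (pi / 2 * c i))) {0..pi / 2}"
      by (intro has_integral_sum) auto
    with I[of n] have "I n = (\<Sum>i<n. (c i * x ^ (2 * i)) * (pi / 2 * c i))" by (rule has_integral_unique)
    then show ?thesis by (simp add: power2_eq_square mult_ac)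
  qed
  then have "I = (\<lambda>n. \<Sum>i<n. pi / 2 * (c i)\<^sup>2 * x ^ (2 * i))" by blast
  ultimately show ?thesis using lim unfolding sums_def c_def by simp
qed

lemma elliptic_K_strict_mono:
  assumes "0 \<le> x" "x < y" "y < 1"
  shows "elliptic_K x < elliptic_K y"
proof -
  let ?a = "\<lambda>n. pi / 2 * (pochhammer (1 / 2) n / fact n)\<^sup>2 :: real"
  have d: "(\<lambda>n. ?a n * y ^ (2 * n) - ?a n * x ^ (2 * n)) sums (elliptic_K y - elliptic_K x)"
    using assms by (intro sums_diff elliptic_K_series) auto
  have "0 < (\<Sum>n. ?a n * y ^ (2 * n) - ?a n * x ^ (2 * n))"
  \<comment> \<open>The terms of index 0 cancel, so index 1 supplies the strictness.\<close>
  proof (rule suminf_pos2[where i = 1])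
    show "summable (\<lambda>n. ?a n * y ^ (2 * n) - ?a n * x ^ (2 * n))" using d by (rule sums_summable)
    fix n show "0 \<le> ?a n * y ^ (2 * n) - ?a n * x ^ (2 * n)"
      using assms by (auto intro!: mult_left_mono power_mono)
  next
    have "x\<^sup>2 < y\<^sup>2" using assms by (intro power_strict_mono) auto
    then show "0 < ?a 1 * y ^ (2 * 1) - ?a 1 * x ^ (2 * 1)" by (simp add: numeral_2_eq_2)
  qed
  then show ?thesis using sums_unique[OF d] by simp
qed

lemma elliptic_K_pos: "0 < elliptic_K x" if "0 \<le> x" "x < 1"
proof -
  have "elliptic_K 0 = pi / 2" by (simp add: elliptic_K_def)
  then have "0 < elliptic_K 0" by (metis pi_half_gt_zero)
  moreover have "x = 0 \<or> elliptic_K 0 < elliptic_K x" using that elliptic_K_strict_mono[of 0 x] by linarith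
  ultimately show ?thesis by auto
qed

section \<open>The contiguous series for 2 K(k) / pi\<close>

text \<open>Shifting the parameter by one changes only the end factors: (3/2)_n = (2 n + 1) (1/2)_n
  and (-1/2)_n = - (1/2)_n / (2 n - 1).\<close>

lemma pochhammer_contiguous:
  "pochhammer (3 / 2) n * pochhammer (- 1 / 2) n = - ((2 * real n + 1) / (2 * real n - 1)) * (pochhammer (1 / 2) n)\<^sup>2"
proof (induction n)
  case (Suc n)
  have nz: "2 * real n - 1 \<noteq> 0" "2 * real n + 1 \<noteq> 0"
  proof -
    have "2 * n \<noteq> 1" by presburger
    then have "real (2 * n) \<noteq> real 1" unfolding of_nat_eq_iff .
    then show "2 * real n - 1 \<noteq> 0" by simp
  qed linarith
  have "pochhammer (3 / 2) (Suc n) * pochhammer (- 1 / 2) (Suc n) =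
     (pochhammer (3 / 2) n * pochhammer (- 1 / 2) n) * ((3 / 2 + real n) * (real n - 1 / 2))"
    by (simp add: pochhammer_Suc algebra_simps)
  also have "\<dots> = - ((2 * real n + 3) / (2 * real n + 1)) * ((pochhammer (1 / 2) n)\<^sup>2 * (1 / 2 + real n)\<^sup>2)"
    unfolding Suc using nz by (simp add: divide_simps) (simp add: power2_eq_square algebra_simps)
  also have "\<dots> = - ((2 * real (Suc n) + 1) / (2 * real (Suc n) - 1)) * (pochhammer (1 / 2) (Suc n))\<^sup>2"
    by (simp add: pochhammer_Suc power_mult_distrib add.commute)
  finally show ?case .
qed simp

lemma elliptic_K_contiguous_series:
  assumes k: "\<bar>k\<bar> < 1"
  shows "(\<lambda>n. pochhammer (3 / 2) n * pochhammer (- 1 / 2) n / (fact n)\<^sup>2 * k ^ (2 * n) *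
            (- 4 * (1 - k\<^sup>2) * real n + 1 - 2 * k\<^sup>2)) sums (2 * elliptic_K k / pi)"
proof -
  define a where "a = (\<lambda>n. (pochhammer (1 / 2) n / fact n)\<^sup>2 :: real)"
  txt \<open>The given summand is the summand of the series for \<open>2 K(k) / \<pi>\<close> plus
    \<open>w (n + 1) - w n\<close>, and \<open>w 0 = 0\<close>.\<close>
  define w where "w = (\<lambda>n. - (8 * (real n)\<^sup>2 / (2 * real n - 1)) * a n * (k\<^sup>2) ^ n)"
  have nz: "2 * real n - 1 \<noteq> 0" "2 * real n + 1 \<noteq> 0" for n
  proof -
    have "2 * n \<noteq> 1" by presburger
    then have "real (2 * n) \<noteq> real 1" unfolding of_nat_eq_iff .
    then show "2 * real n - 1 \<noteq> 0" by simp
  qed linarith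
  have a: "0 \<le> a n" "a n \<le> 1" for n
    using pochhammer_half_bounds[of n] by (auto simp: a_def power_le_one)
  have aS: "a (Suc n) = ((2 * real n + 1) / (2 * real n + 2))\<^sup>2 * a n" for n
    unfolding a_def pochhammer_half_ratio power_mult_distrib ..
  have k2: "\<bar>k\<^sup>2\<bar> < 1" using k by (simp add: abs_square_less_1)
  have "w \<longlonglongrightarrow> 0"
  proof (rule Lim_null_comparison)
    have "(\<lambda>n. 8 * (real n * (k\<^sup>2) ^ n)) \<longlonglongrightarrow> 8 * 0"
      using k2 by (intro tendsto_intros powser_times_n_limit_0) auto
    then show "(\<lambda>n. 8 * (real n * (k\<^sup>2) ^ n)) \<longlonglongrightarrow> 0" by simp
    have "\<bar>w n\<bar> \<le> 8 * (real n * (k\<^sup>2) ^ n)" for n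
    proof (cases n)
      case (Suc m)
      have "\<bar>8 * (real n)\<^sup>2 / (2 * real n - 1)\<bar> \<le> 8 * real n"
        unfolding Suc by (simp add: field_simps power2_eq_square)
      then have "\<bar>8 * (real n)\<^sup>2 / (2 * real n - 1)\<bar> * a n * (k\<^sup>2) ^ n \<le> 8 * real n * 1 * (k\<^sup>2) ^ n"
        using a[of n] by (intro mult_right_mono mult_mono) auto
      then show ?thesis using a[of n] by (simp add: w_def abs_mult)
    qed (simp add: w_def)
    then show "\<forall>\<^sub>F n in sequentially. norm (w n) \<le> 8 * (real n * (k\<^sup>2) ^ n)" by simp
  qed
  then have "(\<lambda>n. w (Suc n) - w n) sums (0 - w 0)" by (rule telescope_sums)
  moreover have "(\<lambda>n. 2 / pi * (pi / 2 * a n * k ^ (2 * n))) sums (2 / pi * elliptic_K k)"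
    using elliptic_K_series[OF k] unfolding a_def by (rule sums_mult)
  ultimately have "(\<lambda>n. 2 / pi * (pi / 2 * a n * k ^ (2 * n)) + (w (Suc n) - w n)) sums (2 / pi * elliptic_K k + (0 - w 0))"
    by (intro sums_add)
  moreover have "2 / pi * (pi / 2 * a n * k ^ (2 * n)) + (w (Suc n) - w n) =
     pochhammer (3 / 2) n * pochhammer (- 1 / 2) n / (fact n)\<^sup>2 * k ^ (2 * n) *
            (- 4 * (1 - k\<^sup>2) * real n + 1 - 2 * k\<^sup>2)" for n
  proof -
    have wS: "w (Suc n) = - (2 * (2 * real n + 1)) * k\<^sup>2 * (a n * (k\<^sup>2) ^ n)"
    proof -
      \<comment> \<open>The numerator \<open>8 * n^2\<close> of \<open>w\<close>, taken at
        \<open>n + 1\<close>, cancels the denominator of the ratio \<open>aS\<close>, so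
        \<open>w (Suc n)\<close> has a polynomial factor.\<close>
      have "8 * (real n + 1)\<^sup>2 / (2 * real n + 1) * ((2 * real n + 1) / (2 * real n + 2))\<^sup>2 = 2 * (2 * real n + 1)"
      proof -
        have "8 * p\<^sup>2 / m * (m / (2 * p))\<^sup>2 = 2 * m" if "m \<noteq> 0" "p \<noteq> 0" for m p :: real
          using that by (simp add: power_divide power_mult_distrib) (simp add: field_simps power2_eq_square)
        from this[OF nz(2)[of n], of "real n + 1"] show ?thesis by (simp add: distrib_left)
      qed
      then show ?thesis unfolding w_def aS by (simp add: add.commute mult_ac)
    qed
    have wn: "w n = - (8 * (real n)\<^sup>2 / (2 * real n - 1)) * (a n * (k\<^sup>2) ^ n)" by (simp add: w_def)
    \<comment> \<open>The telescoping claim after division by \<open>a n * (k^2) ^ n\<close>; both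
      sides are linear in k^2.\<close>
    have id: "1 - 2 * (2 * real n + 1) * k\<^sup>2 + 8 * (real n)\<^sup>2 / (2 * real n - 1) =
       - ((2 * real n + 1) / (2 * real n - 1)) * (- 4 * (1 - k\<^sup>2) * real n + 1 - 2 * k\<^sup>2)"
      using nz[of n] by (simp add: divide_simps) (simp add: algebra_simps power2_eq_square)
    have pc: "pochhammer (3 / 2) n * pochhammer (- 1 / 2) n / (fact n)\<^sup>2 * k ^ (2 * n) = - ((2 * real n + 1) / (2 * real n - 1)) * (a n * (k\<^sup>2) ^ n)"
      unfolding pochhammer_contiguous a_def by (simp add: power_divide power_mult)
    have kk: "2 / pi * (pi / 2 * a n * k ^ (2 * n)) = 1 * (a n * (k\<^sup>2) ^ n)" by (simp add: power_mult)
    have "1 * A + (- B * C * A - - z * A) = (1 - B * C + z) * A" for A B C z :: real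
      by (simp add: algebra_simps)
    note distr = this
    show ?thesis unfolding kk wS wn distr id pc by (simp only: mult_ac)
  qed
  ultimately show ?thesis by (simp add: w_def)
qed

subsection \<open>The nome and the singular modulus\<close>

text \<open>The complementary modulus \<open>k' = \<theta>\<^sub>4(q)\<^sup>2 / \<theta>\<^sub>3(q)\<^sup>2\<close>, with \<open>\<theta>\<^sub>4(q) = \<theta>\<^sub>3(- q)\<close>.\<close>

definition theta_comodulus :: "real \<Rightarrow> real" where
  "theta_comodulus q = (theta3 (- q) / theta3 q)\<^sup>2"

lemma theta_comodulus_bounds:
  assumes "0 < q" "q < 1" shows "0 < theta_comodulus q" "theta_comodulus q < 1"
proof -
  have "0 < theta3 (- q) / theta3 q" "theta3 (- q) / theta3 q < 1"
    using theta3_uminus_pos[OF assms] theta3_uminus_less[OF assms] by auto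
  then show "0 < theta_comodulus q" "theta_comodulus q < 1"
    by (auto simp: theta_comodulus_def power_less_one_iff)
qed

section \<open>Limits as \<open>q\<close> tends to 0 from the right, and both elliptic integrals in
  terms of \<open>theta3\<close>\<close>

lemma pow_pow2_at_right_0:
  fixes q :: real assumes "0 < q" "q < 1"
  shows "filterlim (\<lambda>n. q ^ 2 ^ n) (at_right 0) sequentially"
  using tendsto_pow_pow2[of q] pow_pow2_bounds[OF assms] assms
  by (intro tendsto_imp_filterlim_at_right) auto

lemma filterlim_uminus_at_0: "filterlim (\<lambda>q::real. - q) (at 0) (at 0)"
  by (intro filterlim_atI) (auto intro!: tendsto_eq_intros simp: eventually_at_filter)

text \<open>The last limit adds the difference quotients of \<open>theta3\<close> at 0 along
  \<open>q\<close> and along \<open>- q\<close>; it leads to the constant 16 in k^2 ~ 16 q.\<close>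

lemma theta3_limits_at_right:
  "((\<lambda>q::real. theta3 q) \<longlongrightarrow> 1) (at_right 0)" "((\<lambda>q::real. theta3 (- q)) \<longlongrightarrow> 1) (at_right 0)"
  "((\<lambda>q::real. (theta3 q - theta3 (- q)) / q) \<longlongrightarrow> 4) (at_right 0)"
proof -
  have le: "at_right 0 \<le> at (0::real)" by (simp add: at_le)
  show "((\<lambda>q::real. theta3 q) \<longlongrightarrow> 1) (at_right 0)"
    by (rule tendsto_mono[OF le theta3_tendsto_1])
  show "((\<lambda>q::real. theta3 (- q)) \<longlongrightarrow> 1) (at_right 0)"
    by (rule tendsto_mono[OF le filterlim_compose[OF theta3_tendsto_1 filterlim_uminus_at_0]])
  have "((\<lambda>q::real. (theta3 q - 1) / q + (theta3 (- q) - 1) / (- q)) \<longlongrightarrow> 2 + 2) (at 0)"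
    by (intro tendsto_add theta3_deriv_0 filterlim_compose[OF theta3_deriv_0 filterlim_uminus_at_0])
  moreover have "(theta3 q - 1) / q + (theta3 (- q) - 1) / (- q) = (theta3 q - theta3 (- q)) / q" for q :: real
    by (cases "q = 0") (simp_all add: field_simps)
  ultimately show "((\<lambda>q::real. (theta3 q - theta3 (- q)) / q) \<longlongrightarrow> 4) (at_right 0)"
    using tendsto_mono[OF le] by fastforce
qed

text \<open>A mean step squares the nome and preserves the integral. Along \<open>q ^ 2 ^ n\<close>
  both arguments tend to 1, so \<open>gauss_integral_bounds\<close> forces the value pi / 2.\<close>

lemma gauss_integral_theta3:
  fixes q :: real assumes q: "0 < q" "q < 1"
  shows "gauss_integral ((theta3 q)\<^sup>2) ((theta3 (- q))\<^sup>2) = pi / 2"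
proof -
  let ?G = "\<lambda>q. gauss_integral ((theta3 q)\<^sup>2) ((theta3 (- q))\<^sup>2)"
  have step: "?G q = ?G (q\<^sup>2)" if q: "0 < q" "q < 1" for q
  proof -
    have "\<bar>q\<bar> < 1" using q by simp
    note A = theta3_square_add_uminus[OF this] and G = theta3_mult_uminus[OF this]
    have p: "0 < theta3 (- q)" "0 < theta3 q"
      using theta3_uminus_pos[OF q] theta3_uminus_less[OF q] by auto
    have "((theta3 q)\<^sup>2 + (theta3 (- q))\<^sup>2) / 2 = (theta3 (q\<^sup>2))\<^sup>2" using A by simp
    moreover have "sqrt ((theta3 q)\<^sup>2 * (theta3 (- q))\<^sup>2) = (theta3 (- q\<^sup>2))\<^sup>2"
      using G p by (simp add: real_sqrt_mult)
    ultimately show ?thesis using gauss_integral_landen[of "(theta3 q)\<^sup>2" "(theta3 (- q))\<^sup>2"] p by simp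
  qed
  have G: "?G (q ^ 2 ^ n) = ?G q" for n
  proof (induction n)
    case (Suc n)
    then show ?case using step[OF pow_pow2_bounds[OF q, of n]] unfolding pow_pow2_Suc by simp
  qed simp
  have b: "pi / 2 / (theta3 (q ^ 2 ^ n))\<^sup>2 \<le> ?G q" "?G q \<le> pi / 2 / (theta3 (- (q ^ 2 ^ n)))\<^sup>2" for n
  proof -
    note p = theta3_uminus_pos[OF pow_pow2_bounds[OF q, of n]] theta3_uminus_less[OF pow_pow2_bounds[OF q, of n]]
    then have "(theta3 (- (q ^ 2 ^ n)))\<^sup>2 \<le> (theta3 (q ^ 2 ^ n))\<^sup>2" by (intro power_mono) auto
    with p show "pi / 2 / (theta3 (q ^ 2 ^ n))\<^sup>2 \<le> ?G q" "?G q \<le> pi / 2 / (theta3 (- (q ^ 2 ^ n)))\<^sup>2"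
      using gauss_integral_bounds[of "(theta3 (- (q ^ 2 ^ n)))\<^sup>2" "(theta3 (q ^ 2 ^ n))\<^sup>2"] unfolding G by auto
  qed
  have "(\<lambda>n. pi / 2 / (theta3 (q ^ 2 ^ n))\<^sup>2) \<longlonglongrightarrow> pi / 2 / 1\<^sup>2"
    by (intro tendsto_intros filterlim_compose[OF theta3_limits_at_right(1) pow_pow2_at_right_0[OF q]]) auto
  then have "pi / 2 \<le> ?G q" using b by (intro LIMSEQ_le_const2) auto
  have "(\<lambda>n. pi / 2 / (theta3 (- (q ^ 2 ^ n)))\<^sup>2) \<longlonglongrightarrow> pi / 2 / 1\<^sup>2"
    by (intro tendsto_intros filterlim_compose[OF theta3_limits_at_right(2) pow_pow2_at_right_0[OF q]]) auto
  then have "?G q \<le> pi / 2" using b by (intro LIMSEQ_le_const) auto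
  with \<open>pi / 2 \<le> ?G q\<close> show ?thesis by simp
qed

lemma elliptic_K_theta_modulus:
  fixes q :: real assumes q: "0 < q" "q < 1"
  shows "elliptic_K (sqrt (1 - (theta_comodulus q)\<^sup>2)) = pi / 2 * (theta3 q)\<^sup>2"
proof -
  note p = theta3_uminus_pos[OF q] theta3_uminus_less[OF q]
  then have "(theta3 (- q))\<^sup>2 \<le> (theta3 q)\<^sup>2" by (intro power_mono) auto
  from gauss_integral_eq_elliptic_K[OF _ this] p
  show ?thesis unfolding gauss_integral_theta3[OF q] by (simp add: theta_comodulus_def power_divide field_simps)
qed

text \<open>The ascending transformation takes the comodulus at \<open>q\<close> to that at
  \<open>q^2\<close>. Its factor \<open>1 + x\<close> is twice the ratio of the squared theta
  values, so the normalisation leaves exactly 2.\<close>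

lemma elliptic_K_comodulus_double:
  fixes q :: real assumes q: "0 < q" "q < 1"
  shows "elliptic_K (theta_comodulus (q\<^sup>2)) / (theta3 (q\<^sup>2))\<^sup>2 = 2 * (elliptic_K (theta_comodulus q) / (theta3 q)\<^sup>2)"
proof -
  have "\<bar>q\<bar> < 1" using q by simp
  note A = theta3_square_add_uminus[OF this] and G = theta3_mult_uminus[OF this]
  have p: "0 < theta3 (- q)" "0 < theta3 q"
    using theta3_uminus_pos[OF q] theta3_uminus_less[OF q] by auto
  have p2: "0 < theta3 (q\<^sup>2)" using theta3_ge_1[of "q\<^sup>2"] q by (simp add: power_less_one_iff)
  define x where "x = theta_comodulus q"
  have x: "0 < x" "x < 1" using theta_comodulus_bounds[OF q] by (auto simp: x_def)
  have x1: "1 + x = 2 * (theta3 (q\<^sup>2))\<^sup>2 / (theta3 q)\<^sup>2"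
    unfolding A[symmetric] using p by (simp add: x_def theta_comodulus_def power_divide field_simps)
  have "2 * sqrt x / (1 + x) = theta_comodulus (q\<^sup>2)"
  proof -
    have "sqrt x = theta3 (- q) / theta3 q" using p by (simp add: x_def theta_comodulus_def)
    then show ?thesis
      unfolding x1 using p p2 G[symmetric]
      by (simp add: theta_comodulus_def power_divide) (simp add: field_simps power2_eq_square)
  qed
  with elliptic_K_ascending[OF x] have "elliptic_K (theta_comodulus (q\<^sup>2)) = (1 + x) * elliptic_K (theta_comodulus q)"
    by (simp add: x_def)
  then show ?thesis unfolding x1 using p p2 by (simp add: field_simps)
qed

text \<open>The logarithmic bounds at modulus k' involve ln k, and k^2 = q R(q) with R tending to
  16. Hence - ln k is - ln q / 2 up to a bounded term, which explains the limit 1/2.\<close>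

lemma elliptic_K_comodulus_asymptotic:
  "((\<lambda>q. elliptic_K (theta_comodulus q) / (theta3 q)\<^sup>2 / (- ln q)) \<longlongrightarrow> 1 / 2) (at_right 0)"
proof -
  let ?k = theta_comodulus
  define R where "R = (\<lambda>q. (1 - (?k q)\<^sup>2) / q)"
  \<comment> \<open>The lower logarithmic bound divided by \<open>- ln q\<close>, with the
    contribution of \<open>ln q\<close> separated as the constant 1/2.\<close>
  define L where "L = (\<lambda>q. ((ln (1 + ?k q) - ln (R q) / 2) / (- ln q) + 1 / 2) / ?k q)"
  have ev: "\<forall>\<^sub>F q in at_right 0. q \<in> {0<..<(1::real)}"
    by (rule eventually_at_right_real) simp
  have k1: "(?k \<longlongrightarrow> 1) (at_right 0)"
  proof -
    have "((\<lambda>q::real. (theta3 (- q) / theta3 q)\<^sup>2) \<longlongrightarrow> (1 / 1)\<^sup>2) (at_right 0)"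
      by (intro tendsto_intros theta3_limits_at_right) auto
    then show ?thesis by (simp add: theta_comodulus_def[abs_def])
  qed
  have R16: "(R \<longlongrightarrow> 16) (at_right 0)"
  proof -
    \<comment> \<open>Factoring the difference of fourth powers isolates the one vanishing factor,
      whose quotient by \<open>q\<close> tends to 4; the other factors tend to 2 and 2.\<close>
    have "((\<lambda>q::real. (theta3 q - theta3 (- q)) / q * ((theta3 q + theta3 (- q)) * ((theta3 q)\<^sup>2 + (theta3 (- q))\<^sup>2)) / (theta3 q) ^ 4)
        \<longlongrightarrow> 4 * ((1 + 1) * (1\<^sup>2 + 1\<^sup>2)) / 1 ^ 4) (at_right 0)"
      by (intro tendsto_intros theta3_limits_at_right) auto
    moreover have "\<forall>\<^sub>F q in at_right 0. (theta3 q - theta3 (- q)) / q * ((theta3 q + theta3 (- q)) * ((theta3 q)\<^sup>2 + (theta3 (- q))\<^sup>2)) / (theta3 q) ^ 4 = R q"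
      using ev
    proof eventually_elim
      case (elim q)
      then have t: "theta3 q \<ge> 1" by (intro theta3_ge_1) auto
      then have "1 - (?k q)\<^sup>2 = ((theta3 q) ^ 4 - (theta3 (- q)) ^ 4) / (theta3 q) ^ 4"
        by (simp add: theta_comodulus_def power_divide diff_divide_distrib flip: power_mult)
      also have "(theta3 q) ^ 4 - (theta3 (- q)) ^ 4 = (theta3 q - theta3 (- q)) * ((theta3 q + theta3 (- q)) * ((theta3 q)\<^sup>2 + (theta3 (- q))\<^sup>2))"
        by algebra
      finally show ?case by (simp add: R_def)
    qed
    ultimately show ?thesis by (simp add: tendsto_cong)
  qed
  have lninf: "filterlim (\<lambda>q::real. - ln q) at_top (at_right 0)"
    using ln_at_0 by (simp add: filterlim_uminus_at_top)
  then have lninf': "filterlim (\<lambda>q::real. - ln q) at_infinity (at_right 0)"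
    by (rule filterlim_at_top_imp_at_infinity)
  have "((\<lambda>q. (ln (1 + ?k q) - ln (R q) / 2) / (- ln q)) \<longlongrightarrow> 0) (at_right 0)"
  proof (rule tendsto_divide_0[OF _ lninf'])
    show "((\<lambda>q. ln (1 + ?k q) - ln (R q) / 2) \<longlongrightarrow> ln (1 + 1) - ln 16 / 2) (at_right 0)"
      by (intro tendsto_intros k1 R16) auto
  qed
  then have "(L \<longlongrightarrow> (0 + 1 / 2) / 1) (at_right 0)"
    unfolding L_def by (intro tendsto_intros k1) auto
  then have L: "(L \<longlongrightarrow> 1 / 2) (at_right 0)" by simp
  have "((\<lambda>q. pi / 2 / (- ln q)) \<longlongrightarrow> 0) (at_right 0)"
    by (rule tendsto_divide_0[OF tendsto_const lninf'])
  from tendsto_add[OF L this] have U: "((\<lambda>q. L q + pi / 2 / (- ln q)) \<longlongrightarrow> 1 / 2) (at_right 0)" by simp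
  have bounds: "L q \<le> elliptic_K (?k q) / (- ln q)" "elliptic_K (?k q) / (- ln q) \<le> L q + pi / 2 / (- ln q)"
    if "q \<in> {0<..<1}" for q
  proof -
    have q: "0 < q" "q < 1" using that by auto
    have k: "0 < ?k q" "?k q < 1" using theta_comodulus_bounds[OF q] by auto
    have k2: "0 < 1 - (?k q)\<^sup>2" using k by (simp add: power_less_one_iff)
    have l: "- ln q > 0" using q by simp
    have "ln (sqrt (1 - (?k q)\<^sup>2)) = (ln q + ln (R q)) / 2"
      using k2 q by (simp add: R_def ln_sqrt ln_div)
    then have e: "(ln (1 + ?k q) - ln (sqrt (1 - (?k q)\<^sup>2))) / ?k q = L q * (- ln q)"
    proof -
      have "L q * (- ln q) = (ln (1 + ?k q) - ln (R q) / 2 + 1 / 2 * (- ln q)) / ?k q"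
      proof -
        have cancel: "(X / y + 1 / 2) / z * y = (X + 1 / 2 * y) / z" if "y \<noteq> 0" for X y z :: real
          using that by (simp add: distrib_right)
        show ?thesis unfolding L_def by (rule cancel) (use l in simp)
      qed
      also have "\<dots> = (ln (1 + ?k q) - ln (sqrt (1 - (?k q)\<^sup>2))) / ?k q"
        unfolding \<open>ln (sqrt (1 - (?k q)\<^sup>2)) = (ln q + ln (R q)) / 2\<close> by (simp add: add_divide_distrib)
      finally show ?thesis by simp
    qed
    show "L q \<le> elliptic_K (?k q) / (- ln q)" "elliptic_K (?k q) / (- ln q) \<le> L q + pi / 2 / (- ln q)"
      using elliptic_K_log_bounds[OF k] l unfolding e
      by (simp_all only: pos_le_divide_eq pos_divide_le_eq add_divide_distrib distrib_right) auto
  qed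
  have "((\<lambda>q. elliptic_K (?k q) / (- ln q)) \<longlongrightarrow> 1 / 2) (at_right 0)"
    by (rule tendsto_sandwich[OF _ _ L U]; use ev in eventually_elim) (use bounds in auto)
  from tendsto_divide[OF this tendsto_power[OF theta3_limits_at_right(1), of 2]]
  show ?thesis by (simp add: mult.commute)
qed

text \<open>Squaring \<open>q\<close> doubles both \<open>?M q\<close> and \<open>- ln q\<close>, so
  their quotient is constant along \<open>q ^ 2 ^ n\<close> and equals its limit.\<close>

lemma elliptic_K_comodulus:
  fixes q :: real assumes q: "0 < q" "q < 1"
  shows "elliptic_K (theta_comodulus q) = - ln q / 2 * (theta3 q)\<^sup>2"
proof -
  let ?M = "\<lambda>q. elliptic_K (theta_comodulus q) / (theta3 q)\<^sup>2"
  have M: "?M (q ^ 2 ^ n) = 2 ^ n * ?M q" for n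
  proof (induction n)
    case (Suc n)
    then show ?case using elliptic_K_comodulus_double[OF pow_pow2_bounds[OF q, of n]] unfolding pow_pow2_Suc by simp
  qed simp
  have "?M (q ^ 2 ^ n) / (- ln (q ^ 2 ^ n)) = ?M q / (- ln q)" for n
    unfolding M using q by (simp add: ln_realpow)
  then have "(\<lambda>n::nat. ?M q / (- ln q)) \<longlonglongrightarrow> 1 / 2"
    using filterlim_compose[OF elliptic_K_comodulus_asymptotic pow_pow2_at_right_0[OF q]] by simp
  then have "?M q / (- ln q) = 1 / 2" by (simp add: LIMSEQ_const_iff)
  moreover have "theta3 q \<ge> 1" "ln q < 0" using q by (auto intro!: theta3_ge_1)
  ultimately show ?thesis by (simp add: field_simps)
qed

text \<open>The two theta evaluations give the quotient - ln q / pi = sqrt r, hence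
  existence.\<close>

lemma singular_modulus_eq_theta:
  fixes r :: real assumes "r > 0"
  defines "q \<equiv> exp (- pi * sqrt r)"
  shows "singular_modulus r = sqrt (1 - (theta_comodulus q)\<^sup>2)"
proof -
  have q: "0 < q" "q < 1" using assms by auto
  have k: "0 < theta_comodulus q" "theta_comodulus q < 1" using theta_comodulus_bounds[OF q] by auto
  have k2: "0 < (theta_comodulus q)\<^sup>2" "(theta_comodulus q)\<^sup>2 < 1" using k by (auto simp: power_less_one_iff)
  have t: "theta3 q \<ge> 1" using q by (intro theta3_ge_1) auto
  let ?P = "\<lambda>k. 0 < k \<and> k < 1 \<and> elliptic_K (sqrt (1 - k\<^sup>2)) / elliptic_K k = sqrt r"
  have P: "?P (sqrt (1 - (theta_comodulus q)\<^sup>2))"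
    using k k2 t by (simp add: elliptic_K_theta_modulus[OF q] elliptic_K_comodulus[OF q]) (simp add: q_def)
  \<comment> \<open>Uniqueness: K increases with the modulus and K of the complementary modulus
    decreases, so the quotient is strictly decreasing.\<close>
  have less: False if "?P x" "?P y" "x < y" for x y
  proof -
    have sq: "x\<^sup>2 < y\<^sup>2" "0 < x\<^sup>2" "y\<^sup>2 < 1" using that by (auto intro: power_strict_mono simp: power_less_one_iff)
    have "elliptic_K x < elliptic_K y" using that by (intro elliptic_K_strict_mono) auto
    moreover have "elliptic_K (sqrt (1 - y\<^sup>2)) < elliptic_K (sqrt (1 - x\<^sup>2))"
      using sq by (intro elliptic_K_strict_mono) auto
    moreover have "0 < elliptic_K x" "0 < elliptic_K (sqrt (1 - y\<^sup>2))"
      using that sq by (auto intro!: elliptic_K_pos)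
    ultimately have "elliptic_K (sqrt (1 - y\<^sup>2)) / elliptic_K y < elliptic_K (sqrt (1 - x\<^sup>2)) / elliptic_K x"
      by (intro frac_less) auto
    then show False using that by simp
  qed
  show ?thesis unfolding singular_modulus_def
    by (rule the_equality, rule P) (metis less P linorder_less_linear)
qed

text \<open>The series identity comes from a result valid whenever |k| < 1; the theta value comes
  from the description of \<open>k\<close> by the nome.\<close>

theorem proposition1:
  fixes r k q :: real
  assumes "r > 0"
    and "k = singular_modulus r"
    and "q = exp (- pi * sqrt r)"
  shows "(\<lambda>n. pochhammer (3 / 2) n * pochhammer (- 1 / 2) n / (fact n)\<^sup>2 * k ^ (2 * n) *
            (- 4 * (1 - k\<^sup>2) * real n + 1 - 2 * k\<^sup>2)) sums (2 * elliptic_K k / pi) \<and>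
         2 * elliptic_K k / pi = (theta3 q)\<^sup>2"
proof
  have q: "0 < q" "q < 1" using assms by auto
  have k: "k = sqrt (1 - (theta_comodulus q)\<^sup>2)"
    unfolding assms(2,3) by (rule singular_modulus_eq_theta[OF assms(1)])
  have "0 < (theta_comodulus q)\<^sup>2" "(theta_comodulus q)\<^sup>2 < 1"
    using theta_comodulus_bounds[OF q] by (auto simp: power_less_one_iff)
  then have "\<bar>k\<bar> < 1" by (simp add: k)
  then show "(\<lambda>n. pochhammer (3 / 2) n * pochhammer (- 1 / 2) n / (fact n)\<^sup>2 * k ^ (2 * n) *
            (- 4 * (1 - k\<^sup>2) * real n + 1 - 2 * k\<^sup>2)) sums (2 * elliptic_K k / pi)"
    by (rule elliptic_K_contiguous_series)
  show "2 * elliptic_K k / pi = (theta3 q)\<^sup>2"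
    unfolding k elliptic_K_theta_modulus[OF q] by simp
qed

end
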